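(* We have $$A^{3214}(x,q)=1+I^{3214}(x,q)+I^{321}(x,q)\left(A^{3214}(x,q)-1\right).$$ Moreover, $$I^{3214}(x)=\frac12\left(\sqrt{1-4x}+1\right)\left(E(x)-1\right),$$ $I^{3214}_1=1$, and for $n\ge2$, $$I^{3214}_n=E_n-\sum_{i=0}^{n-2}C_iE_{n-1-i},$$ where $C_i=\frac1{i+1}\binom{2i}i$ is the $i$-th Catalan number, $E_m$ is the number of $1234$-avoiding permutations of $[m]$ ($E_0=1$), and $E(x)=\sum_{m\ge0}E_mx^m$.
   Context: For a permutation $\pi=\pi_1\cdots\pi_n$ of $[n]$, let $i_\pi$ be the smallest index $i$ with $\{\pi_1,\dots,\pi_i\}=\{1,\dots,i\}$; $\pi$ is indecomposable if $i_\pi=n$ (the empty permutation is not indecomposable). A permutation $\pi$ avoids a pattern $\tau\in\mathfrak S_k$ if no subsequence $\pi_{j_1}\cdots\pi_{j_k}$ ($j_1<\cdots<j_k$) is order-isomorphic to $\tau$. A descent of $\pi$ is an index $i$ with $\pi_i>\pi_{i+1}$. For a pattern $\sigma$, $A^\sigma_{n,i}$ (resp. $I^\sigma_{n,i}$) is the number of $\sigma$-avoiding permutations (resp. $\sigma$-avoiding indecomposable permutations) of $[n]$ with $i$ descents; $A^\sigma(x,q)=1+\sum_{n\ge1}\sum_iA^\sigma_{n,i}x^nq^i$, $I^\sigma(x,q)=\sum_{n\ge1}\sum_iI^\sigma_{n,i}x^nq^i$, $I^\sigma(x)=I^\sigma(x,1)=\sum_{n\ge1}I^\sigma_nx^n$.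 It is known that $1234$ and $3214$ are Wilf-equivalent, i.e. $E_m$ also equals the number of $3214$-avoiding permutations of $[m]$. *)

theory Defs
  imports
    "HOL-Analysis.Analysis"
    "HOL-Computational_Algebra.Computational_Algebra"
    "HOL-Combinatorics.Multiset_Permutations"
    "HOL-Library.Sublist"
begin

text \<open>
  A permutation \<open>\<pi>\<close> of \<open>[n]\<close> is the list \<open>[\<pi>\<^sub>1, \<dots>, \<pi>\<^sub>n]\<close> of its values, that is, an element of
  \<^term>\<open>permutations_of_set {1..n::nat}\<close>. Patterns are written in the same way.
\<close>

definition order_isomorphic :: "nat list \<Rightarrow> nat list \<Rightarrow> bool" where
  "order_isomorphic xs ys \<longleftrightarrow>
     length xs = length ys \<and>
     (\<forall>a<length xs. \<forall>b<length xs. xs ! a < xs ! b \<longleftrightarrow> ys ! a < ys ! b)"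

definition avoids :: "nat list \<Rightarrow> nat list \<Rightarrow> bool" where
  "avoids \<tau> \<pi> \<longleftrightarrow> \<not> (\<exists>\<rho>. subseq \<rho> \<pi> \<and> order_isomorphic \<rho> \<tau>)"

definition first_component :: "nat list \<Rightarrow> nat" where
  "first_component \<pi> = (LEAST i. 1 \<le> i \<and> set (take i \<pi>) = {1..i})"

definition indecomposable :: "nat list \<Rightarrow> bool" where
  "indecomposable \<pi> \<longleftrightarrow> \<pi> \<noteq> [] \<and> first_component \<pi> = length \<pi>"

text \<open>List positions start at \<open>0\<close>, so a descent \<open>i\<close> of \<open>\<pi>\<close> is recorded as \<open>i - 1\<close>.\<close>

definition des :: "nat list \<Rightarrow> nat" where
  "des \<pi> = card {i. Suc i < length \<pi> \<and> \<pi> ! i > \<pi> ! Suc i}"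

definition A_num :: "nat list \<Rightarrow> nat \<Rightarrow> nat \<Rightarrow> nat" where
  "A_num \<sigma> n i = card {\<pi> \<in> permutations_of_set {1..n}. avoids \<sigma> \<pi> \<and> des \<pi> = i}"

definition I_num :: "nat list \<Rightarrow> nat \<Rightarrow> nat \<Rightarrow> nat" where
  "I_num \<sigma> n i =
     card {\<pi> \<in> permutations_of_set {1..n}. avoids \<sigma> \<pi> \<and> indecomposable \<pi> \<and> des \<pi> = i}"

text \<open>
  The bivariate series are power series in \<open>x\<close> whose coefficients are polynomials in \<open>q\<close>.
  The inner sums stop at \<open>i = n - 1\<close> because a permutation of \<open>[n]\<close>, \<open>n \<ge> 1\<close>, has at most
  \<open>n - 1\<close> descents.
\<close>

definition A_gf :: "nat list \<Rightarrow> real poly fps" where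
  "A_gf \<sigma> = 1 + Abs_fps (\<lambda>n. if n = 0 then 0 else \<Sum>i<n. monom (of_nat (A_num \<sigma> n i)) i)"

definition I_gf :: "nat list \<Rightarrow> real poly fps" where
  "I_gf \<sigma> = Abs_fps (\<lambda>n. if n = 0 then 0 else \<Sum>i<n. monom (of_nat (I_num \<sigma> n i)) i)"

text \<open>\<open>I\<^sup>\<sigma>(x) = I\<^sup>\<sigma>(x, 1)\<close>; its coefficients are the numbers \<open>I\<^sup>\<sigma>\<^sub>n\<close>.\<close>

definition I_gf1 :: "nat list \<Rightarrow> real fps" where
  "I_gf1 \<sigma> = Abs_fps (\<lambda>n. poly (fps_nth (I_gf \<sigma>) n) 1)"

definition E_num :: "nat \<Rightarrow> nat" where
  "E_num m = card {\<pi> \<in> permutations_of_set {1..m}. avoids [1, 2, 3, 4] \<pi>}"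

definition E_gf :: "real fps" where
  "E_gf = Abs_fps (\<lambda>m. real (E_num m))"

definition catalan :: "nat \<Rightarrow> real" where
  "catalan i = 1 / real (i + 1) * real ((2 * i) choose i)"

lemma des_less_length: "\<pi> \<noteq> [] \<Longrightarrow> des \<pi> < length \<pi>"
proof -
  assume ne: "\<pi> \<noteq> []"
  have "card {i. Suc i < length \<pi> \<and> \<pi> ! i > \<pi> ! Suc i} \<le> card {..<length \<pi> - 1}"
    by (rule card_mono) auto
  with ne show ?thesis unfolding des_def by (cases \<pi>) auto
qed

lemma I_gf1_nth:
  assumes "n \<ge> 1"
  shows "fps_nth (I_gf1 \<sigma>) n =
    real (card {\<pi> \<in> permutations_of_set {1..n}. avoids \<sigma> \<pi> \<and> indecomposable \<pi>})"
proof -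
  let ?S = "{\<pi> \<in> permutations_of_set {1..n}. avoids \<sigma> \<pi> \<and> indecomposable \<pi>}"
  have fin: "finite ?S" by simp
  have "des \<pi> < n" if "\<pi> \<in> ?S" for \<pi>
    using that des_less_length[of \<pi>] length_finite_permutations_of_set[of \<pi> "{1..n}"]
    by (auto simp: indecomposable_def)
  then have "des ` ?S \<subseteq> {..<n}" by auto
  then have "card ?S = (\<Sum>i<n. card {\<pi> \<in> ?S. des \<pi> = i})"
    using sum.group[OF fin finite_lessThan, of des n "\<lambda>_. 1::nat"] by simp
  also have "\<dots> = (\<Sum>i<n. I_num \<sigma> n i)"
    unfolding I_num_def by (intro sum.cong refl arg_cong[where f = card]) auto
  finally have "card ?S = (\<Sum>i<n. I_num \<sigma> n i)" .
  then show ?thesis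
    using assms by (simp add: I_gf1_def I_gf_def poly_sum poly_monom)
qed

end

theory Submission
  imports Defs
begin

text \<open>
  Cutting a permutation after its first component writes it as \<open>\<alpha> \<oplus> \<beta>\<close> with \<open>\<alpha>\<close> indecomposable;
  if \<open>\<beta>\<close> is nonempty, \<open>\<alpha> \<oplus> \<beta>\<close> avoids \<open>3214\<close> iff \<open>\<alpha>\<close> avoids \<open>321\<close> and \<open>\<beta>\<close> avoids \<open>3214\<close>. The
  same cut for \<open>321\<close>, whose avoiders are counted by the Catalan numbers, gives
  \<open>I\<^sup>3\<^sup>2\<^sup>1(x) = x C(x)\<close>, and \<open>1 - x C(x) = (\<surd>(1 - 4x) + 1) / 2\<close>.

  That \<open>1234\<close> and \<open>3214\<close> are Wilf-equivalent is proved by reading a permutation from left to right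
  and keeping only the entries that still matter. The state is then a permutation avoiding \<open>123\<close>
  (resp. \<open>321\<close>), to which one appends an entry or from which one deletes the maximum. Under the
  Robinson-Schensted correspondence, after transposition in the case of \<open>123\<close>, the number of
  continuations depends only on the insertion tableau, which has at most two rows; summed over the
  tableaux of a given shape it obeys a recursion on shapes that is the same for both patterns.
\<close>

subsection \<open>Patterns of length three and four\<close>

text \<open>Robinson-Schensted itself is never constructed. Of the insertion tableau only the
  descents matter for \<open>321\<close>, and for \<open>123\<close> only the initial interval of
  values in the first column; both can be read off a permutation from the relative positions of
  consecutive values. The obstacle is that appending an entry may create the pattern of length
  three, and such a state has no two-row tableau. Deleting its maximum leaves its count unchanged,
  so subtracting the count of the state without its maximum makes it vanish; the subtracted terms
  can be summed because appending commutes with deletion. The price is signed terms, hence counts in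
  \<open>int\<close>. The two patterns do not agree tableau by tableau: for the two tableaux of
  shape (2,1), two further entries give the counts 18, 18 for \<open>321\<close> but 19, 17 for
  \<open>123\<close>. Only the sums over all tableaux of a shape agree, which is why sums over
  ballot words of fixed length and height are compared.\<close>

lemma subseq_append_single:
  "subseq xs (ys @ [y]) \<longleftrightarrow> subseq xs ys \<or> (\<exists>zs. xs = zs @ [y] \<and> subseq zs ys)"
proof -
  have iff: "subseq vs [y] \<longleftrightarrow> vs = [] \<or> vs = [y]" for vs
    by (cases vs) (auto simp: subseq_Cons' split: if_splits)
  have "subseq xs (ys @ [y]) \<longleftrightarrow> (\<exists>us vs. xs = us @ vs \<and> subseq us ys \<and> (vs = [] \<or> vs = [y]))"
    unfolding subseq_append_iff iff ..
  also have "\<dots> \<longleftrightarrow> subseq xs ys \<or> (\<exists>zs. xs = zs @ [y] \<and> subseq zs ys)"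
    by (simp add: conj_disj_distribL ex_disj_distrib)
  finally show ?thesis .
qed

lemma subseq_map_iff: "subseq xs (map f ys) \<longleftrightarrow> (\<exists>zs. xs = map f zs \<and> subseq zs ys)"
proof
  assume "subseq xs (map f ys)"
  then obtain N where "xs = nths (map f ys) N" by (auto simp: subseq_conv_nths)
  then show "\<exists>zs. xs = map f zs \<and> subseq zs ys"
    using subseq_conv_nths by (auto simp: nths_map)
next
  assume "\<exists>zs. xs = map f zs \<and> subseq zs ys"
  then show "subseq xs (map f ys)" by (auto intro: subseq_map)
qed

lemma subseq_filter_iff: "subseq xs (filter P ys) \<longleftrightarrow> subseq xs ys \<and> list_all P xs"
proof
  assume "subseq xs (filter P ys)"
  moreover have "subseq (filter P ys) ys" by simp
  ultimately show "subseq xs ys \<and> list_all P xs"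
    by (metis subseq_order.trans filter_is_subset set_filter list_all_iff
        set_nths_subset subseq_conv_nths subsetD mem_Collect_eq)
next
  assume "subseq xs ys \<and> list_all P xs"
  then show "subseq xs (filter P ys)"
    by (metis list_all_iff filter_True subseq_filter)
qed

text \<open>
  With \<open>R = (<)\<close> these are avoidance of \<open>123\<close> and \<open>1234\<close>, with \<open>R = (>)\<close> avoidance of
  \<open>321\<close> and \<open>3214\<close>; treating \<open>R\<close> as a parameter allows one counting argument for both.
\<close>

definition av3 :: "(nat \<Rightarrow> nat \<Rightarrow> bool) \<Rightarrow> nat list \<Rightarrow> bool" where
  "av3 R xs \<longleftrightarrow> \<not> (\<exists>x y z. subseq [x, y, z] xs \<and> R x y \<and> R y z)"

definition av31 :: "(nat \<Rightarrow> nat \<Rightarrow> bool) \<Rightarrow> nat list \<Rightarrow> bool" where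
  "av31 R xs \<longleftrightarrow>
     \<not> (\<exists>x y z w. subseq [x, y, z, w] xs \<and> R x y \<and> R y z \<and> x < w \<and> y < w \<and> z < w)"

lemma length_3_conv: "length xs = 3 \<longleftrightarrow> (\<exists>x y z. xs = [x, y, z])"
  by (auto simp: numeral_eq_Suc length_Suc_conv)

lemma length_4_conv: "length xs = 4 \<longleftrightarrow> (\<exists>x y z w. xs = [x, y, z, w])"
  by (auto simp: numeral_eq_Suc length_Suc_conv)

lemma order_isomorphic_321:
  "order_isomorphic xs [3, 2, 1] \<longleftrightarrow> (\<exists>x y z. xs = [x, y, z] \<and> x > y \<and> y > z)"
proof -
  have "order_isomorphic xs [3, 2, 1] \<longleftrightarrow> length xs = 3 \<and> order_isomorphic xs [3, 2, 1]"
    by (auto simp: order_isomorphic_def)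
  also have "\<dots> \<longleftrightarrow> (\<exists>x y z. xs = [x, y, z] \<and> order_isomorphic xs [3, 2, 1])"
    by (auto simp: length_3_conv)
  also have "\<dots> \<longleftrightarrow> (\<exists>x y z. xs = [x, y, z] \<and> x > y \<and> y > z)"
    by (intro ex_cong1 conj_cong refl)
       (auto simp: order_isomorphic_def All_less_Suc2)
  finally show ?thesis .
qed

lemma order_isomorphic_3214:
  "order_isomorphic xs [3, 2, 1, 4] \<longleftrightarrow> (\<exists>x y z w. xs = [x, y, z, w] \<and> x > y \<and> y > z \<and> x < w)"
proof -
  have "order_isomorphic xs [3, 2, 1, 4] \<longleftrightarrow> length xs = 4 \<and> order_isomorphic xs [3, 2, 1, 4]"
    by (auto simp: order_isomorphic_def)
  also have "\<dots> \<longleftrightarrow> (\<exists>x y z w. xs = [x, y, z, w] \<and> order_isomorphic xs [3, 2, 1, 4])"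
    by (auto simp: length_4_conv)
  also have "\<dots> \<longleftrightarrow> (\<exists>x y z w. xs = [x, y, z, w] \<and> x > y \<and> y > z \<and> x < w)"
    by (intro ex_cong1 conj_cong refl)
       (auto simp: order_isomorphic_def All_less_Suc2)
  finally show ?thesis .
qed

lemma order_isomorphic_1234:
  "order_isomorphic xs [1, 2, 3, 4] \<longleftrightarrow> (\<exists>x y z w. xs = [x, y, z, w] \<and> x < y \<and> y < z \<and> z < w)"
proof -
  have "order_isomorphic xs [1, 2, 3, 4] \<longleftrightarrow> length xs = 4 \<and> order_isomorphic xs [1, 2, 3, 4]"
    by (auto simp: order_isomorphic_def)
  also have "\<dots> \<longleftrightarrow> (\<exists>x y z w. xs = [x, y, z, w] \<and> order_isomorphic xs [1, 2, 3, 4])"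
    by (auto simp: length_4_conv)
  also have "\<dots> \<longleftrightarrow> (\<exists>x y z w. xs = [x, y, z, w] \<and> x < y \<and> y < z \<and> z < w)"
    by (intro ex_cong1 conj_cong refl)
       (auto simp: order_isomorphic_def All_less_Suc2)
  finally show ?thesis .
qed

lemma avoids_321: "avoids [3, 2, 1] xs \<longleftrightarrow> av3 (>) xs"
  unfolding avoids_def av3_def order_isomorphic_321 by blast

lemma avoids_3214: "avoids [3, 2, 1, 4] xs \<longleftrightarrow> av31 (>) xs"
proof -
  have eq: "x > y \<and> y > z \<and> x < w \<longleftrightarrow> x > y \<and> y > z \<and> x < w \<and> y < w \<and> z < w" for x y z w :: nat
    by linarith
  show ?thesis unfolding avoids_def av31_def order_isomorphic_3214 eq by blast
qed

lemma avoids_1234: "avoids [1, 2, 3, 4] xs \<longleftrightarrow> av31 (<) xs"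
proof -
  have eq: "x < y \<and> y < z \<and> z < w \<longleftrightarrow> x < y \<and> y < z \<and> x < w \<and> y < w \<and> z < w" for x y z w :: nat
    by linarith
  show ?thesis unfolding avoids_def av31_def order_isomorphic_1234 eq by blast
qed

section \<open>Appending a last entry of given rank, and deleting the maximum\<close>

definition perms :: "nat \<Rightarrow> nat list set" where
  "perms n = permutations_of_set {1..n}"

lemma perms_iff: "xs \<in> perms n \<longleftrightarrow> set xs = {1..n} \<and> distinct xs"
  by (simp add: perms_def permutations_of_set_def)

lemma perms_length: "xs \<in> perms n \<Longrightarrow> length xs = n"
  using distinct_card[of xs] by (auto simp: perms_iff)

lemma finite_perms [simp]: "finite (perms n)"
  by (simp add: perms_def)

lemma perms_0 [simp]: "perms 0 = {[]}"
  by (simp add: perms_def)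

definition shift_from :: "nat \<Rightarrow> nat \<Rightarrow> nat" where
  "shift_from a v = (if v < a then v else Suc v)"

definition append_rank :: "nat \<Rightarrow> nat list \<Rightarrow> nat list" where
  "append_rank a xs = map (shift_from a) xs @ [a]"

definition delete_max :: "nat list \<Rightarrow> nat list" where
  "delete_max xs = filter (\<lambda>v. v < length xs) xs"

lemma shift_from_less_iff [simp]: "shift_from a x < shift_from a y \<longleftrightarrow> x < y"
  by (auto simp: shift_from_def)

lemma shift_from_eq_iff [simp]: "shift_from a x = shift_from a y \<longleftrightarrow> x = y"
  by (auto simp: shift_from_def)

lemma shift_from_neq [simp]: "shift_from a x \<noteq> a" "a \<noteq> shift_from a x"
  by (auto simp: shift_from_def)

lemma length_append_rank [simp]: "length (append_rank a xs) = Suc (length xs)"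
  by (simp add: append_rank_def)

lemma shift_from_image:
  assumes "1 \<le> a" "a \<le> Suc n"
  shows "insert a (shift_from a ` {1..n}) = {1..Suc n}"
proof -
  have "x \<in> shift_from a ` {1..n}" if "x \<in> {1..Suc n}" "x \<noteq> a" for x
  proof (cases "x < a")
    case True
    then show ?thesis using that assms by (intro image_eqI[of _ _ x]) (auto simp: shift_from_def)
  next
    case False
    then show ?thesis using that assms by (intro image_eqI[of _ _ "x - 1"]) (auto simp: shift_from_def)
  qed
  moreover have "shift_from a ` {1..n} \<subseteq> {1..Suc n}"
    by (auto simp: shift_from_def)
  moreover have "a \<in> {1..Suc n}" using assms by simp
  ultimately show ?thesis by blast
qed

lemma append_rank_perms:
  assumes "xs \<in> perms n" "a \<in> {1..Suc n}"
  shows "append_rank a xs \<in> perms (Suc n)"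
  using assms shift_from_image[of a n]
  by (auto simp: perms_iff append_rank_def distinct_map inj_on_def)

lemma append_rank_inj: "append_rank a xs = append_rank b ys \<longleftrightarrow> a = b \<and> xs = ys"
proof
  assume "append_rank a xs = append_rank b ys"
  then have "a = b" and "map (shift_from a) xs = map (shift_from a) ys"
    by (auto simp: append_rank_def)
  moreover have "inj (shift_from a)" by (simp add: inj_on_def)
  ultimately show "a = b \<and> xs = ys" by simp
qed auto

lemma append_rank_surj:
  assumes "ys \<in> perms (Suc n)"
  shows "\<exists>a\<in>{1..Suc n}. \<exists>xs\<in>perms n. ys = append_rank a xs"
proof -
  define a where "a = last ys"
  define xs where "xs = map (\<lambda>v. if v < a then v else v - 1) (butlast ys)"
  have ne: "ys \<noteq> []" using assms by (auto simp: perms_iff)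
  then have ys: "ys = butlast ys @ [a]" by (simp add: a_def)
  have a: "a \<in> {1..Suc n}" using assms ne a_def by (metis perms_iff last_in_set)
  have d: "distinct (butlast ys)" "a \<notin> set (butlast ys)"
    using assms ys by (metis perms_iff distinct_append not_distinct_conv_prefix distinct_butlast)+
  have sb: "set (butlast ys) = {1..Suc n} - {a}"
  proof -
    have "insert a (set (butlast ys)) = {1..Suc n}"
      using assms ys by (metis perms_iff Un_insert_right boolean_algebra_cancel.sup0 list.set set_append)
    with d show ?thesis by blast
  qed
  have m: "map (shift_from a) xs = butlast ys"
  proof -
    have "shift_from a (if v < a then v else v - 1) = v" if "v \<in> set (butlast ys)" for v
    proof -
      have "v \<noteq> a" using that d by blast
      then show ?thesis by (cases "v < a") (simp_all add: shift_from_def)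
    qed
    then show ?thesis by (simp add: xs_def map_idI)
  qed
  have "ys = append_rank a xs" using ys m by (simp add: append_rank_def)
  moreover have "xs \<in> perms n"
  proof -
    have "distinct xs" using d m by (metis distinct_map)
    moreover have "set xs = {1..n}"
    proof -
      have "shift_from a ` set xs = {1..Suc n} - {a}" using m sb by (metis set_map)
      also have "\<dots> = shift_from a ` {1..n}" using shift_from_image[of a n] a
by auto
      finally show ?thesis
        by (subst (asm) inj_image_eq_iff) (simp_all add: inj_on_def)
    qed
    ultimately show ?thesis by (simp add: perms_iff)
  qed
  ultimately show ?thesis using a by blast
qed

text \<open>A permutation is determined by its last value and the relative order of the rest, so a
  class described by a condition on parent and rank can be summed parent by parent.\<close>

lemma sum_append_rank:
  assumes "\<And>xs a. xs \<in> perms n \<Longrightarrow> a \<in> {1..Suc n} \<Longrightarrow> B (append_rank a xs) \<longleftrightarrow> B' xs \<and> Q a xs"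
  shows "(\<Sum>ys\<in>{ys \<in> perms (Suc n). B ys}. f ys) =
    (\<Sum>xs\<in>{xs \<in> perms n. B' xs}. \<Sum>a\<in>{a \<in> {1..Suc n}. Q a xs}. f (append_rank a xs))"
proof -
  let ?D = "Sigma {xs \<in> perms n. B' xs} (\<lambda>xs. {a \<in> {1..Suc n}. Q a xs})"
  have "bij_betw (\<lambda>(xs, a). append_rank a xs) ?D {ys \<in> perms (Suc n). B ys}"
    unfolding bij_betw_def
  proof
    show "inj_on (\<lambda>(xs, a). append_rank a xs) ?D"
      by (auto simp: inj_on_def append_rank_inj)
    show "(\<lambda>(xs, a). append_rank a xs) ` ?D = {ys \<in> perms (Suc n). B ys}"
    proof (intro equalityI subsetI)
      fix ys assume "ys \<in> (\<lambda>(xs, a). append_rank a xs) ` ?D"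
      then show "ys \<in> {ys \<in> perms (Suc n). B ys}"
        using assms append_rank_perms by (auto simp del: atLeastAtMost_iff)
    next
      fix ys assume ys: "ys \<in> {ys \<in> perms (Suc n). B ys}"
      then obtain a xs where "a \<in> {1..Suc n}" "xs \<in> perms n" "ys = append_rank a xs"
        using append_rank_surj by blast
      with ys assms have "(xs, a) \<in> ?D" "ys = (\<lambda>(xs, a). append_rank a xs) (xs, a)" by auto
      then show "ys \<in> (\<lambda>(xs, a). append_rank a xs) ` ?D" by blast
    qed
  qed
  then have "(\<Sum>ys\<in>{ys \<in> perms (Suc n). B ys}. f ys) = (\<Sum>(xs, a)\<in>?D. f (append_rank a xs))"
    by (simp add: sum.reindex_bij_betw[symmetric] case_prod_unfold)
  then show ?thesis by (simp add: sum.Sigma)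
qed

lemma delete_max_perms:
  assumes "xs \<in> perms (Suc n)"
  shows "delete_max xs \<in> perms n"
  using assms perms_length[OF assms] by (auto simp: perms_iff delete_max_def)

text \<open>A rank of at most \<open>Suc n\<close> stays below the old maximum, which is shifted and
  remains the maximum. The one remaining rank, on top of everything, is the case of
  \<open>delete_max_append_top\<close>.\<close>

lemma delete_max_append_rank:
  assumes "xs \<in> perms (Suc n)" "a \<in> {1..Suc n}"
  shows "delete_max (append_rank a xs) = append_rank a (delete_max xs)"
  using assms perms_length[OF assms(1)]
  by (auto simp: delete_max_def append_rank_def filter_map o_def shift_from_def
      intro!: filter_cong arg_cong[where f = "map _"])

lemma append_top:
  assumes "xs \<in> perms n"
  shows "append_rank (Suc n) xs = xs @ [Suc n]"
  using assms by (auto simp: append_rank_def perms_iff shift_from_def intro!: map_idI)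

lemma delete_max_append_top:
  assumes "xs \<in> perms n"
  shows "delete_max (append_rank (Suc n) xs) = xs"
  using assms perms_length[OF assms] unfolding append_top[OF assms]
  by (auto simp: delete_max_def perms_iff intro!: filter_True)

subsection \<open>Counting by appended entries\<close>

lemma subseq_append_single_triple:
  "subseq [x, y, z] (ys @ [a]) \<longleftrightarrow> subseq [x, y, z] ys \<or> z = a \<and> subseq [x, y] ys"
  by (auto simp: subseq_append_single append_eq_Cons_conv Cons_eq_append_conv)

lemma subseq_append_single_pair:
  "subseq [x, y] (ys @ [a]) \<longleftrightarrow> subseq [x, y] ys \<or> y = a \<and> x \<in> set ys"
  by (auto simp: subseq_append_single append_eq_Cons_conv Cons_eq_append_conv subseq_singleton_left)

lemma subseq_append_single_quad:
  "subseq [x, y, z, w] (ys @ [a]) \<longleftrightarrow> subseq [x, y, z, w] ys \<or> w = a \<and> subseq [x, y, z] ys"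
  by (auto simp: subseq_append_single append_eq_Cons_conv Cons_eq_append_conv)

lemma shift_from_order:
  assumes "R = (<) \<or> R = (>)"
  shows "R (shift_from a x) (shift_from a y) \<longleftrightarrow> R x y"
  using assms by auto

lemma shift_from_less: "shift_from a x < a \<longleftrightarrow> x < a"
  by (auto simp: shift_from_def)

lemma subseq_map_pair:
  "subseq [x, y] (map f ys) \<longleftrightarrow> (\<exists>x' y'. x = f x' \<and> y = f y' \<and> subseq [x', y'] ys)"
  unfolding subseq_map_iff by (auto simp: Cons_eq_map_conv)

lemma subseq_map_triple:
  "subseq [x, y, z] (map f ys) \<longleftrightarrow>
     (\<exists>x' y' z'. x = f x' \<and> y = f y' \<and> z = f z' \<and> subseq [x', y', z'] ys)"
proof
  assume "\<exists>x' y' z'. x = f x' \<and> y = f y' \<and> z = f z' \<and> subseq [x', y', z'] ys"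
  then show "subseq [x, y, z] (map f ys)"
    using subseq_map[of "[_, _, _]" ys f] by auto
qed (auto simp: subseq_map_iff Cons_eq_map_conv)

lemma subseq_map_quad:
  "subseq [x, y, z, w] (map f ys) \<longleftrightarrow>
     (\<exists>x' y' z' w'. x = f x' \<and> y = f y' \<and> z = f z' \<and> w = f w' \<and> subseq [x', y', z', w'] ys)"
proof
  assume "\<exists>x' y' z' w'. x = f x' \<and> y = f y' \<and> z = f z' \<and> w = f w' \<and> subseq [x', y', z', w'] ys"
  then show "subseq [x, y, z, w] (map f ys)"
    using subseq_map[of "[_, _, _, _]" ys f] by auto
qed (auto simp: subseq_map_iff Cons_eq_map_conv)

lemma av3_filter: "av3 R xs \<Longrightarrow> av3 R (filter P xs)"
  by (auto simp: av3_def subseq_filter_iff)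

text \<open>A new occurrence ends in the new entry. Comparing with \<open>shift_from a y\<close>
  covers both relations: for \<open>(<)\<close> it means \<open>y < a\<close>, for
  \<open>(>)\<close> it means \<open>y \<ge> a\<close>.\<close>

lemma av3_append_rank:
  assumes "R = (<) \<or> R = (>)"
  shows "av3 R (append_rank a xs) \<longleftrightarrow>
    av3 R xs \<and> \<not> (\<exists>x y. subseq [x, y] xs \<and> R x y \<and> R (shift_from a y) a)"
proof -
  have "av3 R (append_rank a xs) \<longleftrightarrow> av3 R (map (shift_from a) xs) \<and>
      \<not> (\<exists>x y. subseq [x, y] (map (shift_from a) xs) \<and> R x y \<and> R y a)"
    unfolding av3_def append_rank_def subseq_append_single_triple by blast
  also have "av3 R (map (shift_from a) xs) \<longleftrightarrow> av3 R xs"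
    unfolding av3_def subseq_map_triple using shift_from_order[OF assms] by blast
  also have "(\<exists>x y. subseq [x, y] (map (shift_from a) xs) \<and> R x y \<and> R y a) \<longleftrightarrow>
      (\<exists>x y. subseq [x, y] xs \<and> R x y \<and> R (shift_from a y) a)"
    unfolding subseq_map_pair using shift_from_order[OF assms] by blast
  finally show ?thesis .
qed

lemma av31_append_rank:
  assumes "R = (<) \<or> R = (>)"
  shows "av31 R (append_rank a xs) \<longleftrightarrow> av31 R xs \<and> av3 R (filter (\<lambda>v. v < a) xs)"
proof -
  have "av31 R (append_rank a xs) \<longleftrightarrow> av31 R (map (shift_from a) xs) \<and>
      \<not> (\<exists>x y z. subseq [x, y, z] (map (shift_from a) xs) \<and> R x y \<and> R y z \<and> x < a \<and> y < a \<and> z < a)"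
    unfolding av31_def append_rank_def subseq_append_single_quad by blast
  also have "av31 R (map (shift_from a) xs) \<longleftrightarrow> av31 R xs"
    unfolding av31_def subseq_map_quad using shift_from_order[OF assms] shift_from_less_iff by blast
  also have "(\<exists>x y z. subseq [x, y, z] (map (shift_from a) xs) \<and> R x y \<and> R y z \<and> x < a \<and> y < a \<and> z < a) \<longleftrightarrow>
      (\<exists>x y z. subseq [x, y, z] xs \<and> R x y \<and> R y z \<and> x < a \<and> y < a \<and> z < a)"
    unfolding subseq_map_triple using shift_from_order[OF assms] shift_from_less by blast
  also have "\<dots> \<longleftrightarrow> \<not> av3 R (filter (\<lambda>v. v < a) xs)"
    unfolding av3_def subseq_filter_iff by (simp add: conj_ac)
  finally show ?thesis by simp
qed

text \<open>
  An appended entry \<open>a\<close> completes a forbidden pattern of length four exactly if the entries below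
  \<open>a\<close> contain the pattern of length three.
\<close>

primrec extensions :: "(nat \<Rightarrow> nat \<Rightarrow> bool) \<Rightarrow> nat \<Rightarrow> nat list \<Rightarrow> int" where
  "extensions R 0 xs = 1"
| "extensions R (Suc m) xs =
     (\<Sum>a\<in>{a \<in> {1..Suc (length xs)}. av3 R (filter (\<lambda>v. v < a) xs)}. extensions R m (append_rank a xs))"

text \<open>One letter of the prefix is traded for one more step of \<open>extensions\<close>; after
  \<open>n\<close> trades only the empty prefix is left.\<close>

lemma card_av31:
  assumes "R = (<) \<or> R = (>)"
  shows "int (card {xs \<in> perms n. av31 R xs}) = extensions R n []"
proof -
  let ?N = "\<lambda>n. {xs \<in> perms n. av31 R xs}"
  have step: "(\<Sum>xs\<in>?N (Suc n). extensions R m xs) = (\<Sum>xs\<in>?N n. extensions R (Suc m) xs)" for n m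
    by (subst sum_append_rank[where B' = "av31 R" and Q = "\<lambda>a xs. av3 R (filter (\<lambda>v. v < a) xs)"])
       (auto simp: av31_append_rank[OF assms] perms_length intro!: sum.cong simp del: atLeastAtMost_iff)
  have "(\<Sum>xs\<in>?N n. extensions R m xs) = (\<Sum>xs\<in>?N 0. extensions R (m + n) xs)" for m
  proof (induction n arbitrary: m)
    case (Suc n)
    show ?case using step[of m n] Suc.IH[of "Suc m"] by (simp del: extensions.simps)
  qed simp
  from this[of 0] show ?thesis by (simp add: av31_def Collect_conv_if)
qed

text \<open>
  Once the pattern of length three occurs, no later entry exceeds the maximum, so the maximum
  plays no further role.
\<close>

lemma extensions_delete_max:
  assumes R: "R = (<) \<or> R = (>)" and "xs \<in> perms (Suc n)" "\<not> av3 R xs"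
  shows "extensions R m xs = extensions R m (delete_max xs)"
  using assms(2,3)
proof (induction m arbitrary: n xs)
  case (Suc m)
  let ?ys = "delete_max xs"
  have len: "length xs = Suc n" "length ?ys = n"
    using Suc.prems delete_max_perms perms_length by blast+
  have top: "filter (\<lambda>v. v < Suc (Suc n)) xs = xs"
    using Suc.prems(1) by (intro filter_True) (auto simp: perms_iff)
  have low: "filter (\<lambda>v. v < a) ?ys = filter (\<lambda>v. v < a) xs" if "a \<le> Suc n" for a
    using that len by (auto simp: delete_max_def intro!: filter_cong)
  \<comment> \<open>Ranks up to \<open>Suc n\<close> see the same smaller entries in both lists. The
    only extra rank for \<open>xs\<close>, namely \<open>Suc (Suc n)\<close>, lies above an
    occurrence of the pattern and is forbidden.\<close>
  have "{a \<in> {1..Suc (length xs)}. av3 R (filter (\<lambda>v. v < a) xs)} =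
      {a \<in> {1..Suc (length ?ys)}. av3 R (filter (\<lambda>v. v < a) ?ys)}" (is "?A = ?B")
  proof -
    have "a \<noteq> Suc (Suc n)" if "av3 R (filter (\<lambda>v. v < a) xs)" for a
      using that top Suc.prems(2) by auto
    then show ?thesis using low len by (auto simp: le_Suc_eq)
  qed
  moreover have "extensions R m (append_rank a xs) = extensions R m (append_rank a ?ys)"
    if "a \<in> ?B" for a
  proof -
    have a: "a \<in> {1..Suc n}" using that len by simp
    then have "append_rank a xs \<in> perms (Suc (Suc n))"
      using append_rank_perms[OF Suc.prems(1), of a] by simp
    moreover have "\<not> av3 R (append_rank a xs)"
      using Suc.prems(2) av3_append_rank[OF R] by blast
    ultimately show ?thesis
      using Suc.IH delete_max_append_rank[OF Suc.prems(1) a] by simp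
  qed
  ultimately show ?case by simp
qed simp

text \<open>Every rank may be appended to an avoider. From each child the count of the child without
  its maximum is subtracted, which cancels the children containing the pattern. The subtracted
  counts are then added back: for ranks up to \<open>n\<close> deletion commutes with appending, and
  together they are one step further from \<open>delete_max xs\<close>; rank \<open>Suc n\<close> is
  the maximum itself, and its deletion returns \<open>xs\<close>.\<close>

lemma extensions_rec:
  assumes R: "R = (<) \<or> R = (>)" and xs: "xs \<in> perms n" and av: "av3 R xs"
  shows "extensions R (Suc m) xs =
    (if n = 0 then 0 else extensions R (Suc m) (delete_max xs)) +
    (\<Sum>a\<in>{a \<in> {1..Suc n}. av3 R (append_rank a xs)}.
       extensions R m (append_rank a xs) - extensions R m (delete_max (append_rank a xs))) +
    extensions R m xs"
proof -
  let ?d = "\<lambda>a. extensions R m (append_rank a xs) - extensions R m (delete_max (append_rank a xs))"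
  have "(\<Sum>a\<in>{a \<in> {1..Suc n}. av3 R (append_rank a xs)}. ?d a) = (\<Sum>a\<in>{1..Suc n}. ?d a)"
    using extensions_delete_max[OF R append_rank_perms[OF xs]]
    by (intro sum.mono_neutral_left) auto
  also have "\<dots> = (\<Sum>a\<in>{1..Suc n}. extensions R m (append_rank a xs)) -
      (\<Sum>a\<in>{1..Suc n}. extensions R m (delete_max (append_rank a xs)))"
    by (rule sum_subtractf)
  also have "(\<Sum>a\<in>{1..Suc n}. extensions R m (append_rank a xs)) = extensions R (Suc m) xs"
    using av perms_length[OF xs]
    by (simp add: av3_filter del: sum.cl_ivl_Suc atLeastAtMost_iff)
  also have "(\<Sum>a\<in>{1..Suc n}. extensions R m (delete_max (append_rank a xs))) =
      (\<Sum>a\<in>{1..n}. extensions R m (delete_max (append_rank a xs))) + extensions R m xs"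
    by (simp add: delete_max_append_top[OF xs])
  also have "(\<Sum>a\<in>{1..n}. extensions R m (delete_max (append_rank a xs))) =
      (if n = 0 then 0 else extensions R (Suc m) (delete_max xs))"
  proof (cases n)
    case (Suc k)
    have xs': "xs \<in> perms (Suc k)" using xs Suc by simp
    have "av3 R (delete_max xs)" using av by (simp add: delete_max_def av3_filter)
    moreover have "length (delete_max xs) = k"
      using delete_max_perms[OF xs'] perms_length by blast
    ultimately show ?thesis
      using delete_max_append_rank[OF xs']
      by (simp add: Suc av3_filter del: sum.cl_ivl_Suc atLeastAtMost_iff)
  qed simp
  finally show ?thesis by simp
qed

subsection \<open>Inverse descents\<close>

declare extensions.simps(2) [simp del]

lemma upt_split: "i \<le> j \<Longrightarrow> j \<le> k \<Longrightarrow> [i..<k] = [i..<j] @ [j..<k]"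
  using upt_add_eq_append[of i j "k - j"] by simp

lemma subseq_pair_Cons:
  "subseq [x, y] (z # zs) \<longleftrightarrow> x = z \<and> y \<in> set zs \<or> subseq [x, y] zs"
  using list_emb_set[of "(=)" "[x, y]" zs] by (auto simp: subseq_Cons' subseq_singleton_left)

lemma subseq_pair_in_set: "subseq [x, y] xs \<Longrightarrow> x \<in> set xs \<and> y \<in> set xs"
  by (induction xs) (auto simp: subseq_pair_Cons simp del: subseq_Cons2_iff)

lemma subseq_pair_total:
  "x \<in> set xs \<Longrightarrow> y \<in> set xs \<Longrightarrow> x \<noteq> y \<Longrightarrow> subseq [x, y] xs \<or> subseq [y, x] xs"
  by (induction xs) (auto simp: subseq_pair_Cons simp del: subseq_Cons2_iff)

lemma subseq_pair_antisym:
  "distinct xs \<Longrightarrow> subseq [x, y] xs \<Longrightarrow> \<not> subseq [y, x] xs"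
  by (induction xs) (auto simp: subseq_pair_Cons dest: subseq_pair_in_set simp del: subseq_Cons2_iff)

lemma subseq_pair_trans:
  "distinct xs \<Longrightarrow> subseq [x, y] xs \<Longrightarrow> subseq [y, z] xs \<Longrightarrow> subseq [x, z] xs"
  by (induction xs) (auto simp: subseq_pair_Cons dest: subseq_pair_in_set simp del: subseq_Cons2_iff)

lemma subseq_pair_chain_up:
  assumes "distinct xs" "x < y" "\<And>v. x < v \<Longrightarrow> v \<le> y \<Longrightarrow> subseq [v - 1, v] xs"
  shows "subseq [x, y :: nat] xs"
  using assms(2,3)
proof (induction y)
  case (Suc y)
  then show ?case
    using subseq_pair_trans[OF assms(1), of x y "Suc y"] Suc.prems(2)[of "Suc y"]
    by (cases "x = y") auto
qed simp

lemma subseq_pair_chain_down: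
  assumes "distinct xs" "x < y" "\<And>v. x < v \<Longrightarrow> v \<le> y \<Longrightarrow> subseq [v, v - 1] xs"
  shows "subseq [y, x :: nat] xs"
  using assms(2,3)
proof (induction y)
  case (Suc y)
  then show ?case
    using subseq_pair_trans[OF assms(1), of "Suc y" y x] Suc.prems(2)[of "Suc y"]
    by (cases "x = y") auto
qed simp

text \<open>
  The list is indexed by values from the largest down to \<open>1\<close>; the entry of \<open>v\<close> tells whether \<open>v\<close>
  stands to the left of \<open>v - 1\<close> and is \<open>False\<close> for \<open>v = 1\<close>. Correspondingly \<open>insert_level j\<close>
  inserts a new last entry with \<open>j\<close> larger values.
\<close>

definition inv_descents :: "nat list \<Rightarrow> bool list" where
  "inv_descents xs = map (\<lambda>v. subseq [v, v - 1] xs) (rev [1..<Suc (length xs)])"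

definition insert_level :: "nat \<Rightarrow> bool list \<Rightarrow> bool list" where
  "insert_level j bs = (if j = 0 then False # bs else take (j - 1) bs @ [True, False] @ drop j bs)"

lemma length_inv_descents [simp]: "length (inv_descents xs) = length xs"
  by (simp add: inv_descents_def del: upt_Suc)

lemma inv_descents_delete_max:
  assumes "xs \<in> perms (Suc n)"
  shows "inv_descents (delete_max xs) = tl (inv_descents xs)"
proof -
  have len: "length xs = Suc n" "length (delete_max xs) = n"
    using assms delete_max_perms perms_length by blast+
  have "subseq [v, v - 1] (delete_max xs) \<longleftrightarrow> subseq [v, v - 1] xs" if "v \<le> n" for v
    using that len by (auto simp: delete_max_def subseq_filter_iff)
  then show ?thesis by (auto simp: inv_descents_def len)
qed

text \<open>Consecutive old values stay consecutive except \<open>a - 1\<close> and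
  \<open>a\<close>, between which the new value is squeezed. Their bit is replaced by two: the old
  \<open>a\<close>, now \<open>Suc a\<close>, is left of the new last entry, and that entry is not
  left of \<open>a - 1\<close>. On top of all values no pair is separated and only a
  \<open>False\<close> is added.\<close>

lemma inv_descents_append_rank:
  assumes xs: "xs \<in> perms n" and a: "a \<in> {1..Suc n}"
  shows "inv_descents (append_rank a xs) = insert_level (Suc n - a) (inv_descents xs)"
proof -
  define f where "f v = subseq [v, v - 1] (append_rank a xs)" for v
  define g where "g v = subseq [v, v - 1] xs" for v
  have len: "length xs = n" using xs by (rule perms_length)
  have f: "f v \<longleftrightarrow> (\<exists>x y. v = shift_from a x \<and> v - 1 = shift_from a y \<and> subseq [x, y] xs) \<or>
      v - 1 = a \<and> (\<exists>x\<in>set xs. v = shift_from a x)" for v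
    unfolding f_def append_rank_def subseq_append_single_pair subseq_map_pair by auto
  have low: "v = shift_from a x \<longleftrightarrow> x = v" if "v < a" for v x
    using that by (auto simp: shift_from_def)
  have high: "Suc v = shift_from a x \<longleftrightarrow> x = v" if "a \<le> v" for v x
    using that by (auto simp: shift_from_def)
  have f1: "f v = g v" if "1 \<le> v" "v < a" for v
    using that low[of v] low[of "v - 1"] unfolding f g_def by auto
  have f2: "\<not> f a" using a unfolding f by auto
  have f3: "f (Suc a)" if "a \<le> n"
    using that a xs high[of a] unfolding f by (auto simp: perms_iff)
  have f4: "f (Suc v) = g v" if "a < v" for v
    using that high[of v] high[of "v - 1"] unfolding f g_def by auto
  have idf: "inv_descents (append_rank a xs) = map f (rev [1..<Suc (Suc n)])"
    unfolding inv_descents_def f_def length_append_rank len ..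
  have idg: "inv_descents xs = map g (rev [1..<Suc n])"
    unfolding inv_descents_def g_def len ..
  show ?thesis
  proof (cases "a = Suc n")
    case True
    have "map f (rev [1..<Suc (Suc n)]) = f (Suc n) # map f (rev [1..<Suc n])" by simp
    also have "map f (rev [1..<Suc n]) = map g (rev [1..<Suc n])"
      using f1 True by (intro map_cong) auto
    finally show ?thesis using f2 True unfolding idf idg insert_level_def
      by (simp del: upt_Suc)
  next
    case False
    then have an: "1 \<le> a" "a \<le> n" using a by auto
    have "[1..<Suc (Suc n)] = [1..<a] @ [a, Suc a] @ [Suc (Suc a)..<Suc (Suc n)]"
      using an upt_split[of 1 a "Suc (Suc n)"] by (simp add: upt_conv_Cons)
    then have "inv_descents (append_rank a xs) =
        map f (rev [Suc (Suc a)..<Suc (Suc n)]) @ [True, False] @ map f (rev [1..<a])"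
      using f2 f3 an by (simp add: idf del: upt_Suc)
    also have "map f (rev [1..<a]) = map g (rev [1..<a])"
      using f1 by (intro map_cong) auto
    also have "map f (rev [Suc (Suc a)..<Suc (Suc n)]) = map g (rev [Suc a..<Suc n])"
      unfolding map_Suc_upt[symmetric] rev_map map_map o_def using f4 by (intro map_cong) auto
    finally have eq: "inv_descents (append_rank a xs) =
        map g (rev [Suc a..<Suc n]) @ [True, False] @ map g (rev [1..<a])" .
    have "[1..<Suc n] = [1..<a] @ [a] @ [Suc a..<Suc n]"
      using an upt_split[of 1 a "Suc n"] by (simp add: upt_conv_Cons)
    then have "inv_descents xs = map g (rev [Suc a..<Suc n]) @ [g a] @ map g (rev [1..<a])"
      by (simp add: idg del: upt_Suc)
    with eq an show ?thesis by (simp add: insert_level_def Suc_diff_le del: upt_Suc)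
  qed
qed

text \<open>The \<open>j\<close> old values that end up above the new entry must increase from left
  to right; \<open>j\<close> values have \<open>j - 1\<close> comparisons of neighbours, stored at
  the head.\<close>

definition ok321 :: "nat \<Rightarrow> bool list \<Rightarrow> bool" where
  "ok321 j bs \<longleftrightarrow> list_all Not (take (j - 1) bs)"

text \<open>The values below the new entry must decrease from left to right; \<open>butlast\<close>
  discards the entry of value 1, which is \<open>False\<close> by convention.\<close>

definition ok123 :: "nat \<Rightarrow> bool list \<Rightarrow> bool" where
  "ok123 j bs \<longleftrightarrow> list_all id (butlast (drop j bs))"

text \<open>A new occurrence needs an inversion among the old values from \<open>a\<close> on. There
  is none exactly if neighbouring values are in order, since the order of positions is
  transitive.\<close>

lemma ok321_iff:
  assumes xs: "xs \<in> perms n" and a: "a \<in> {1..Suc n}" and av: "av3 (>) xs"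
  shows "av3 (>) (append_rank a xs) \<longleftrightarrow> ok321 (Suc n - a) (inv_descents xs)"
proof -
  have len: "length xs = n" and d: "distinct xs" and s: "set xs = {1..n}"
    using xs perms_length by (auto simp: perms_iff)
  have sh: "shift_from a y > a \<longleftrightarrow> y \<ge> a" for y by (auto simp: shift_from_def)
  have "av3 (>) (append_rank a xs) \<longleftrightarrow> \<not> (\<exists>x y. subseq [x, y] xs \<and> x > y \<and> y \<ge> a)"
    using av3_append_rank[of "(>)" a xs] av sh by simp
  also have "\<dots> \<longleftrightarrow> (\<forall>v. a < v \<longrightarrow> v \<le> n \<longrightarrow> \<not> subseq [v, v - 1] xs)"
  proof safe
    fix v assume *: "\<nexists>x y. subseq [x, y] xs \<and> x > y \<and> y \<ge> a" "a < v" "subseq [v, v - 1] xs"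
    then have "v > v - 1 \<and> v - 1 \<ge> a" by linarith
    with * show False by blast
  next
    fix x y assume *: "\<forall>v. a < v \<longrightarrow> v \<le> n \<longrightarrow> \<not> subseq [v, v - 1] xs" "subseq [x, y] xs" "x > y" "y \<ge> a"
    have x: "x \<le> n" using subseq_pair_in_set[OF *(2)] s by simp
    have "subseq [y, x] xs"
    proof (rule subseq_pair_chain_up[OF d \<open>x > y\<close>])
      fix v assume v: "y < v" "v \<le> x"
      then have v': "v \<in> set xs" "v - 1 \<in> set xs" "v \<noteq> v - 1" "a < v" "v \<le> n"
        using x * a s unfolding s atLeastAtMost_iff by linarith+
      then have "\<not> subseq [v, v - 1] xs" using * by blast
      then show "subseq [v - 1, v] xs"
        using subseq_pair_total[OF v'(1-3)] by blast
    qed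
    then show False using subseq_pair_antisym[OF d *(2)] by blast
  qed
  also have "\<dots> \<longleftrightarrow> ok321 (Suc n - a) (inv_descents xs)"
  proof -
    have "[1..<Suc n] = [1..<Suc a] @ [Suc a..<Suc n]" if "a \<le> n"
      using that a upt_split[of 1 "Suc a" "Suc n"] by simp
    then have "take (n - a) (rev [1..<Suc n]) = rev [Suc a..<Suc n]"
      using a by (cases "a = Suc n") (simp_all del: upt_Suc)
    then have "ok321 (Suc n - a) (inv_descents xs) \<longleftrightarrow>
        list_all Not (map (\<lambda>v. subseq [v, v - 1] xs) (rev [Suc a..<Suc n]))"
      by (simp add: ok321_def inv_descents_def len take_map del: upt_Suc)
    also have "\<dots> \<longleftrightarrow> (\<forall>v\<in>{Suc a..<Suc n}. \<not> subseq [v, v - 1] xs)"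
      by (simp add: list_all_iff del: upt_Suc)
    finally show ?thesis by (auto simp del: upt_Suc)
  qed
  finally show ?thesis .
qed

lemma ok123_iff:
  assumes xs: "xs \<in> perms n" and a: "a \<in> {1..Suc n}" and av: "av3 (<) xs"
  shows "av3 (<) (append_rank a xs) \<longleftrightarrow> ok123 (Suc n - a) (inv_descents xs)"
proof -
  have len: "length xs = n" and d: "distinct xs" and s: "set xs = {1..n}"
    using xs perms_length by (auto simp: perms_iff)
  have "av3 (<) (append_rank a xs) \<longleftrightarrow> \<not> (\<exists>x y. subseq [x, y] xs \<and> x < y \<and> y < a)"
    using av3_append_rank[of "(<)" a xs] av shift_from_less by simp
  also have "\<dots> \<longleftrightarrow> (\<forall>v. 2 \<le> v \<longrightarrow> v < a \<longrightarrow> subseq [v, v - 1] xs)"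
  proof safe
    fix v assume *: "\<nexists>x y. subseq [x, y] xs \<and> x < y \<and> y < a" "2 \<le> v" "v < a"
    have v: "v \<in> set xs" "v - 1 \<in> set xs" "v \<noteq> v - 1" "v - 1 < v"
      using *(2,3) a unfolding s atLeastAtMost_iff by linarith+
    then show "subseq [v, v - 1] xs" using * subseq_pair_total[OF v(1-3)] by blast
  next
    fix x y assume *: "\<forall>v. 2 \<le> v \<longrightarrow> v < a \<longrightarrow> subseq [v, v - 1] xs" "subseq [x, y] xs" "x < y" "y < a"
    have x: "1 \<le> x" using subseq_pair_in_set[OF *(2)] s by simp
    have "subseq [y, x] xs"
      by (rule subseq_pair_chain_down[OF d \<open>x < y\<close>]) (use *(1,4) x in simp)
    then show False using subseq_pair_antisym[OF d *(2)] by blast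
  qed
  also have "\<dots> \<longleftrightarrow> ok123 (Suc n - a) (inv_descents xs)"
  proof -
    have "[1..<Suc n] = [1..<a] @ [a..<Suc n]"
      using a upt_split[of 1 a "Suc n"] by simp
    then have "drop (Suc n - a) (rev [1..<Suc n]) = rev [1..<a]"
      using a by (simp del: upt_Suc)
    moreover have "butlast (rev [1..<a]) = rev [2..<a]"
      by (cases "1 < a") (simp_all add: upt_conv_Cons numeral_2_eq_2)
    ultimately have "ok123 (Suc n - a) (inv_descents xs) \<longleftrightarrow>
        list_all id (map (\<lambda>v. subseq [v, v - 1] xs) (rev [2..<a]))"
      by (simp add: ok123_def inv_descents_def len drop_map map_butlast[symmetric] del: upt_Suc)
    also have "\<dots> \<longleftrightarrow> (\<forall>v\<in>{2..<a}. subseq [v, v - 1] xs)"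
      by (simp add: list_all_iff del: upt_Suc)
    finally show ?thesis by (auto simp del: upt_Suc)
  qed
  finally show ?thesis .
qed

text \<open>
  The recursion of \<open>extensions_rec\<close> read off from inverse descents: among \<open>321\<close>-avoiders (or
  \<open>123\<close>-avoiders) they determine which entries may be appended.
\<close>

function ext_desc :: "(nat \<Rightarrow> bool list \<Rightarrow> bool) \<Rightarrow> nat \<Rightarrow> bool list \<Rightarrow> int" where
  "ext_desc V 0 bs = 1"
| "ext_desc V (Suc m) bs = (if bs = [] then 0 else ext_desc V (Suc m) (tl bs)) +
     (\<Sum>j\<in>{j \<in> {..length bs}. V j bs}.
        ext_desc V m (insert_level j bs) - ext_desc V m (tl (insert_level j bs))) +
     ext_desc V m bs"
  by pat_completeness auto
termination by (relation "measures [\<lambda>(V, m, bs). m, \<lambda>(V, m, bs). length bs]") auto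

declare ext_desc.simps(2) [simp del]

lemma extensions_eq_ext_desc:
  assumes R: "R = (<) \<or> R = (>)"
    and V: "\<And>n a xs. xs \<in> perms n \<Longrightarrow> a \<in> {1..Suc n} \<Longrightarrow> av3 R xs \<Longrightarrow>
      av3 R (append_rank a xs) \<longleftrightarrow> V (Suc n - a) (inv_descents xs)"
    and "xs \<in> perms n" "av3 R xs"
  shows "extensions R m xs = ext_desc V m (inv_descents xs)"
  using assms(3,4)
proof (induction m arbitrary: n xs)
  case (Suc m)
  note outer = Suc.IH
  have sum: "(\<Sum>a\<in>{a \<in> {1..Suc n}. av3 R (append_rank a xs)}.
      extensions R m (append_rank a xs) - extensions R m (delete_max (append_rank a xs))) =
    (\<Sum>j\<in>{j \<in> {..length bs}. V j bs}.
      ext_desc V m (insert_level j bs) - ext_desc V m (tl (insert_level j bs)))"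
    if xs: "xs \<in> perms n" and av: "av3 R xs" and bs: "bs = inv_descents xs" for n xs bs
  proof (rule sum.reindex_bij_witness[of _ "\<lambda>j. Suc n - j" "\<lambda>a. Suc n - a"])
    fix a assume *: "a \<in> {a \<in> {1..Suc n}. av3 R (append_rank a xs)}"
    then have a: "a \<in> {1..Suc n}" "av3 R (append_rank a xs)" by blast+
    have p: "append_rank a xs \<in> perms (Suc n)" using append_rank_perms xs a by blast
    show "Suc n - a \<in> {j \<in> {..length bs}. V j bs}"
      using V[OF xs a(1) av] a xs bs by (auto simp: perms_length)
    have "av3 R (delete_max (append_rank a xs))"
      using a by (simp add: delete_max_def av3_filter)
    then show "ext_desc V m (insert_level (Suc n - a) bs) - ext_desc V m (tl (insert_level (Suc n - a) bs)) =
      extensions R m (append_rank a xs) - extensions R m (delete_max (append_rank a xs))"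
      using Suc.IH[OF p] Suc.IH[OF delete_max_perms[OF p]] a
      by (simp add: bs inv_descents_append_rank[OF xs a(1)] inv_descents_delete_max[OF p])
  next
    fix j assume j: "j \<in> {j \<in> {..length bs}. V j bs}"
    then have "Suc n - j \<in> {1..Suc n}" "Suc n - (Suc n - j) = j"
      using xs bs by (auto simp: perms_length)
    then show "Suc n - j \<in> {a \<in> {1..Suc n}. av3 R (append_rank a xs)}"
      using V[OF xs _ av, of "Suc n - j"] j bs by auto
  qed (use xs bs in \<open>auto simp: perms_length\<close>)
  \<comment> \<open>The recursion removes the maximum while keeping \<open>Suc m\<close>, so an
    inner induction on the size is required.\<close>
  from Suc.prems show ?case
  proof (induction n arbitrary: xs)
    case 0
    have "inv_descents xs = []" using 0 by (simp add: inv_descents_def)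
    then show ?case
      using Suc.IH[OF 0] by (subst extensions_rec[OF R 0], subst ext_desc.simps(2), subst sum[OF 0 refl]) simp
  next
    case (Suc k)
    note prems = Suc.prems
    have "av3 R (delete_max xs)"
      using prems by (simp add: delete_max_def av3_filter)
    then have "extensions R (Suc m) (delete_max xs) = ext_desc V (Suc m) (tl (inv_descents xs))"
      using Suc.IH[OF delete_max_perms[OF prems(1)]] inv_descents_delete_max[OF prems(1)] by simp
    moreover have "inv_descents xs \<noteq> []"
      using prems(1) perms_length[of xs "Suc k"] by (auto simp: inv_descents_def)
    ultimately show ?case
      using outer[OF prems]
      by (subst extensions_rec[OF R prems], subst ext_desc.simps(2), subst sum[OF prems refl]) simp
  qed
qed simp

text \<open>
  For \<open>123\<close>-avoiders only the size and the length of the longest initial interval \<open>{1..l}\<close> of values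
  that appears in decreasing order matter.
\<close>

function ext_lead :: "nat \<Rightarrow> nat \<Rightarrow> nat \<Rightarrow> int" where
  "ext_lead 0 h l = 1"
| "ext_lead (Suc m) h l = (if h = 0 then 0 else ext_lead (Suc m) (h - 1) (min l (h - 1))) +
     (\<Sum>i\<in>{1..Suc l}. ext_lead m (Suc h) i - ext_lead m h (min i h)) + ext_lead m h l"
  by pat_completeness auto
termination by (relation "measures [\<lambda>(m, h, l). m, \<lambda>(m, h, l). h]") auto

declare ext_lead.simps(2) [simp del]

text \<open>Reversal lists the bits from value 1 upwards. The bit of 1 carries no information and is
  skipped by \<open>tl\<close>, while \<open>Suc\<close> counts the value 1 itself.\<close>

definition lead :: "bool list \<Rightarrow> nat" where
  "lead bs = (if bs = [] then 0 else Suc (length (takeWhile id (tl (rev bs)))))"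

lemma length_takeWhile_butlast:
  "length (takeWhile P (butlast xs)) = min (length (takeWhile P xs)) (length xs - 1)"
  by (induction xs) (auto simp: neq_Nil_conv)

lemma lead_tl:
  assumes "bs \<noteq> []"
  shows "lead (tl bs) = min (lead bs) (length bs - 1)"
proof (cases bs rule: rev_cases)
  case (snoc ds c)
  then show ?thesis
    by (cases ds) (auto simp: lead_def length_takeWhile_butlast[of id "rev _ @ [_]", simplified])
qed (use assms in simp)

lemma lead_le: "lead bs \<le> length bs"
proof (cases "bs = []")
  case False
  have "length (takeWhile id (tl (rev bs))) \<le> length (tl (rev bs))"
    by (rule length_takeWhile_le)
  then show ?thesis using False by (cases bs) (auto simp: lead_def)
qed (simp add: lead_def)

lemma rev_insert_level:
  assumes "k \<le> length cs"
  shows "rev (insert_level (length cs - k) (rev cs)) =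
    take k cs @ False # (if k = length cs then [] else True # drop (Suc k) cs)"
proof (cases "k = length cs")
  case False
  then have "length cs - k - 1 = length cs - Suc k" "k < length cs" using assms by auto
  then show ?thesis
    using False by (simp add: insert_level_def take_rev drop_rev)
qed (simp add: insert_level_def)

lemma list_all_take_iff:
  "k \<le> length xs \<Longrightarrow> list_all P (take k xs) \<longleftrightarrow> k \<le> length (takeWhile P xs)"
  by (induction xs arbitrary: k) (auto simp: take_Cons split: nat.splits)

lemma ok123_lead:
  assumes "bs = [] \<or> \<not> last bs" "k \<le> length bs"
  shows "ok123 (length bs - k) bs \<longleftrightarrow> k \<le> lead bs"
proof (cases bs rule: rev_cases)
  case (snoc ds c)
  then show ?thesis using assms
    by (cases k) (auto simp: ok123_def lead_def butlast_append list_all_take_iff[symmetric] take_rev)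
qed (use assms in \<open>auto simp: ok123_def\<close>)

text \<open>Here \<open>k\<close> counts the smaller values. For \<open>k \<ge> 1\<close> the new
  entry is \<open>k + 1\<close> and stands to the right of \<open>k\<close>, so the decreasing run
  stops at \<open>k\<close>. For \<open>k = 0\<close> it becomes the value 1 at the far right and
  prolongs the old run by one.\<close>

lemma lead_insert_level:
  assumes "bs = [] \<or> \<not> last bs" "k \<le> lead bs"
  shows "lead (insert_level (length bs - k) bs) = (if k = 0 then Suc (lead bs) else k)"
    "\<not> last (insert_level (length bs - k) bs)" "length (insert_level (length bs - k) bs) = Suc (length bs)"
proof -
  define cs where "cs = rev bs"
  have k: "k \<le> length cs" using assms lead_le[of bs] by (simp add: cs_def)
  have cs: "rev (insert_level (length bs - k) bs) =
      take k cs @ False # (if k = length cs then [] else True # drop (Suc k) cs)"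
    using rev_insert_level[OF k] by (simp add: cs_def)
  show "length (insert_level (length bs - k) bs) = Suc (length bs)"
    using arg_cong[OF cs, of length] k by (auto simp: cs_def)
  have ne: "insert_level (length bs - k) bs \<noteq> []" using cs by auto
  have hd: "\<not> hd cs" if "cs \<noteq> []" using that assms by (auto simp: cs_def hd_rev)
  have "\<not> hd (rev (insert_level (length bs - k) bs))"
    unfolding cs using hd by (cases k) (auto simp: hd_append)
  then show "\<not> last (insert_level (length bs - k) bs)" by (simp add: hd_rev)
  show "lead (insert_level (length bs - k) bs) = (if k = 0 then Suc (lead bs) else k)"
  proof (cases cs)
    case Nil
    then show ?thesis using ne cs k by (simp add: lead_def cs_def)
  next
    case (Cons c ds)
    have bs: "lead bs = Suc (length (takeWhile id ds))"
      using Cons by (auto simp: lead_def cs_def)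
    show ?thesis
    proof (cases k)
      case 0
      then show ?thesis using ne cs Cons unfolding bs by (simp add: lead_def)
    next
      case (Suc i)
      then have i: "i \<le> length (takeWhile id ds)" using assms bs by simp
      then have "list_all id (take i ds)" "i \<le> length ds"
        using list_all_take_iff[of i ds id] length_takeWhile_le[of id ds] by auto
      then have "takeWhile id (take i ds @ False # zs) = take i ds" for zs
        by (subst takeWhile_append2) (auto simp: list_all_iff)
      then show ?thesis using ne cs Cons Suc \<open>i \<le> length ds\<close> by (auto simp: lead_def)
    qed
  qed
qed

lemma ext_desc_eq_ext_lead:
  assumes "bs = [] \<or> \<not> last bs"
  shows "ext_desc ok123 m bs = ext_lead m (length bs) (lead bs)"
  using assms
proof (induction m arbitrary: bs)
  case (Suc m)
  note outer = Suc.IH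
  let ?g = "\<lambda>h i. ext_lead m (Suc h) i - ext_lead m h (min i h)"
  have sum: "(\<Sum>j\<in>{j \<in> {..length bs}. ok123 j bs}.
      ext_desc ok123 m (insert_level j bs) - ext_desc ok123 m (tl (insert_level j bs))) =
      (\<Sum>i\<in>{1..Suc (lead bs)}. ?g (length bs) i)"
    if bs: "bs = [] \<or> \<not> last bs" for bs
  proof -
    let ?f = "\<lambda>j. ext_desc ok123 m (insert_level j bs) - ext_desc ok123 m (tl (insert_level j bs))"
    have f: "?f (length bs - k) = ?g (length bs) (if k = 0 then Suc (lead bs) else k)"
      if "k \<le> lead bs" for k
    proof -
      let ?b = "insert_level (length bs - k) bs"
      note b = lead_insert_level[OF bs that]
      have ne: "?b \<noteq> []" using b(3) by auto
      have "tl ?b = [] \<or> \<not> last (tl ?b)" using b(2) by (metis last_tl)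
      then show ?thesis
        using outer[of ?b] outer[of "tl ?b"] b lead_tl[OF ne] by simp
    qed
    have "(\<Sum>j\<in>{j \<in> {..length bs}. ok123 j bs}. ?f j) = (\<Sum>k\<in>{0..lead bs}. ?f (length bs - k))"
      using ok123_lead[OF bs] lead_le[of bs]
      by (intro sum.reindex_bij_witness[of _ "\<lambda>k. length bs - k" "\<lambda>j. length bs - j"])
         (auto, metis diff_diff_cancel diff_le_self)
    \<comment> \<open>The insertion below all values supplies the new lead
      \<open>Suc (lead bs)\<close>, the others supply \<open>1\<close> to \<open>lead bs\<close>;
      together these are the indices summed over in \<open>ext_lead\<close>.\<close>
    also have "\<dots> = ?f (length bs - 0) + (\<Sum>k\<in>{1..lead bs}. ?f (length bs - k))"
      by (simp add: sum.atLeast_Suc_atMost)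
    also have "\<dots> = ?g (length bs) (Suc (lead bs)) + (\<Sum>k\<in>{1..lead bs}. ?g (length bs) k)"
      using f[of 0] f by (intro arg_cong2[where f = "(+)"] sum.cong) simp_all
    finally show ?thesis by simp
  qed
  from Suc.prems show ?case
  proof (induction bs)
    case Nil
    then show ?case
      by (subst ext_desc.simps(2), subst sum, simp, subst ext_lead.simps(2)) (simp add: outer lead_def)
  next
    case (Cons b bs)
    have "bs = [] \<or> \<not> last bs" using Cons.prems by auto
    then have "ext_desc ok123 (Suc m) bs = ext_lead (Suc m) (length bs) (lead bs)"
      by (rule Cons.IH)
    moreover have "lead bs = min (lead (b # bs)) (length bs)"
      using lead_tl[of "b # bs"] by simp
    ultimately show ?case
      by (subst ext_desc.simps(2), subst sum[OF Cons.prems], subst ext_lead.simps(2))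
         (use outer[OF Cons.prems] in simp)
  qed
qed simp

subsection \<open>Sums over ballot words\<close>

text \<open>
  Ballot words are stored in reverse, the last step at the head, and \<open>True\<close> is an up step. They encode
  standard Young tableaux with two rows, \<open>words h d\<close> those of size \<open>h\<close> whose rows differ in length by
  \<open>d\<close>. Summing over \<open>words h d\<close> turns the two recursions into the same one: the pairs (tableau,
  admissible insertion) correspond to words with two more steps by inserting a peak, for
  \<open>123\<close> the first one and for \<open>321\<close> the last one.
\<close>

primrec height :: "bool list \<Rightarrow> int" where
  "height [] = 0"
| "height (x # r) = height r + (if x then 1 else -1)"

primrec ballot :: "bool list \<Rightarrow> bool" where
  "ballot [] \<longleftrightarrow> True"
| "ballot (x # r) \<longleftrightarrow> ballot r \<and> height (x # r) \<ge> 0"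

definition words :: "nat \<Rightarrow> int \<Rightarrow> bool list set" where
  "words h d = {r. length r = h \<and> ballot r \<and> height r = d}"

lemma finite_words [simp]: "finite (words h d)"
  by (rule finite_subset[OF _ finite_lists_length_eq[of UNIV h]]) (auto simp: words_def)

lemma height_le_length: "height r \<le> int (length r)"
  by (induction r) auto

lemma ballot_height_nonneg: "ballot r \<Longrightarrow> height r \<ge> 0"
  by (cases r) auto

lemma even_height: "even (height r + int (length r))"
  by (induction r) auto

lemma words_neg: "d < 0 \<Longrightarrow> words h d = {}"
  using ballot_height_nonneg by (fastforce simp: words_def)

lemma words_gt: "d > int h \<Longrightarrow> words h d = {}"
  by (auto simp: words_def) (metis height_le_length not_le)

lemma words_odd: "odd (d + int h) \<Longrightarrow> words h d = {}"
  using even_height by (fastforce simp: words_def)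

lemma words_0: "words 0 d = (if d = 0 then {[]} else {})"
  by (auto simp: words_def)

lemma words_Suc:
  "d \<ge> 0 \<Longrightarrow> words (Suc h) d = (#) True ` words h (d - 1) \<union> (#) False ` words h (d + 1)"
  by (auto simp: words_def length_Suc_conv image_iff)

lemma sum_words_Suc:
  assumes "d \<ge> 0"
  shows "(\<Sum>r\<in>words (Suc h) d. f r) =
    (\<Sum>r\<in>words h (d - 1). f (True # r)) + (\<Sum>r\<in>words h (d + 1). f (False # r))"
  unfolding words_Suc[OF assms]
  by (subst sum.union_disjoint) (auto simp: sum.reindex)

lemma words_top: "r \<in> words h (int h) \<Longrightarrow> r = replicate h True"
proof (induction h arbitrary: r)
  case (Suc h)
  then obtain x q where r: "r = x # q" "length q = h" by (auto simp: words_def length_Suc_conv)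
  then have "x" and "q \<in> words h (int h)"
    using Suc.prems height_le_length[of q] by (auto simp: words_def split: if_splits)
  then show ?case using Suc.IH r by simp
qed (simp add: words_0)

text \<open>Up steps before the first down step, that is, the run of \<open>True\<close> at the end of the list.\<close>

primrec ups :: "bool list \<Rightarrow> nat" where
  "ups [] = 0"
| "ups (x # r) = (if ups r = length r \<and> x then Suc (ups r) else ups r)"

lemma ups_le: "ups r \<le> length r"
  by (induction r) auto

lemma ups_eq_length: "ups r = length r \<Longrightarrow> height r = int (length r)"
proof (induction r)
  case (Cons x r)
  then show ?case using ups_le[of r] by (auto split: if_splits)
qed simp

lemma ups_less: "r \<in> words h d \<Longrightarrow> d < int h \<Longrightarrow> ups r < h"
  using ups_le[of r] ups_eq_length[of r] by (auto simp: words_def order_less_le)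

lemma ups_replicate [simp]: "ups (replicate h True) = h"
  by (induction h) auto

lemma ups_tl: "r \<noteq> [] \<Longrightarrow> ups (tl r) = min (ups r) (length r - 1)"
  using ups_le[of "tl r"] by (cases r) auto

lemma words_top_eq: "words h (int h) = {replicate h True}"
proof
  have "height (replicate h True) = int h \<and> ballot (replicate h True)"
    by (induction h) auto
  then show "{replicate h True} \<subseteq> words h (int h)" by (simp add: words_def)
qed (use words_top in auto)

text \<open>Removing the first peak from a longer word with \<open>i\<close> initial up steps leaves
  a word with at least \<open>i - 1\<close> of them, so \<open>r\<close> arises once for each
  \<open>i\<close> up to \<open>Suc (ups r)\<close>. The bound on \<open>d\<close> forces a down
  step, hence a peak, in the longer words. The proof is by induction on the last step.\<close>

lemma sum_first_peak:
  fixes g :: "nat \<Rightarrow> int"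
  assumes "0 \<le> d" "d \<le> int h"
  shows "(\<Sum>r\<in>words h d. \<Sum>i\<in>{1..Suc (ups r)}. g i) = (\<Sum>r\<in>words (h + 2) d. g (ups r))"
  using assms
proof (induction h arbitrary: d)
  case 0
  then have "d = 0" by simp
  then show ?case
    by (simp add: sum_words_Suc words_0 numeral_2_eq_2 words_neg)
next
  case (Suc h)
  define G where "G l = (\<Sum>i\<in>{1..Suc l}. g i)" for l
  have lhs: "(\<Sum>r\<in>words (Suc h) d. G (ups r)) =
      (\<Sum>r\<in>words h (d - 1). G (ups (True # r))) + (\<Sum>r\<in>words h (d + 1). G (ups (False # r)))"
    using Suc.prems by (simp add: sum_words_Suc)
  have rhs: "(\<Sum>r\<in>words (Suc h + 2) d. g (ups r)) =
      (\<Sum>r\<in>words (h + 2) (d - 1). g (ups (True # r))) + (\<Sum>r\<in>words (h + 2) (d + 1). g (ups (False # r)))"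
    using Suc.prems by (simp add: sum_words_Suc)
  have IH: "(\<Sum>r\<in>words h e. G (ups r)) = (\<Sum>r\<in>words (h + 2) e. g (ups r))" if "e \<le> int h" for e
  proof (cases "0 \<le> e")
    case True
    then show ?thesis using Suc.IH that by (simp add: G_def)
  qed (simp add: words_neg)
  have up: "ups (True # r) = ups r" if "r \<in> words k e" "e < int k" for r k e
    using ups_less[OF that] that by (auto simp: words_def)
  have down: "ups (False # r) = ups r" for r by simp
  have "(\<Sum>r\<in>words (h + 2) (d - 1). g (ups (True # r))) = (\<Sum>r\<in>words (h + 2) (d - 1). g (ups r))"
    using Suc.prems up[of _ "h + 2" "d - 1"] by (intro sum.cong) auto
  also have "\<dots> = (\<Sum>r\<in>words h (d - 1). G (ups r))"
    using Suc.prems by (simp add: IH)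
  finally have rhs': "(\<Sum>r\<in>words (Suc h + 2) d. g (ups r)) =
      (\<Sum>r\<in>words h (d - 1). G (ups r)) + (\<Sum>r\<in>words (h + 2) (d + 1). g (ups (False # r)))"
    unfolding rhs by simp
  \<comment> \<open>An appended up step lengthens the initial run only if there is no down step,
    which happens at maximal height and is computed by hand. One below that height all sums are
    empty by parity.\<close>
  consider "d = int h + 1" | "d = int h" | "d + 1 \<le> int h" using Suc.prems by fastforce
  then have "(\<Sum>r\<in>words (Suc h) d. G (ups r)) = (\<Sum>r\<in>words (Suc h + 2) d. g (ups r))"
  proof cases
    case 1
    then have d: "d - 1 = int h" "d + 1 = int (h + 2)" by auto
    have "(\<Sum>r\<in>words (Suc h) d. G (ups r)) = G (Suc h)"
      unfolding lhs d words_top_eq by (simp add: words_gt)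
    moreover have "(\<Sum>r\<in>words (Suc h + 2) d. g (ups r)) = G h + g (h + 2)"
      unfolding rhs' d words_top_eq down by simp
    ultimately show ?thesis by (simp add: G_def)
  next
    case 2
    then show ?thesis unfolding lhs rhs'
      using up[of _ h "d - 1"] by (simp add: words_odd)
  next
    case 3
    then show ?thesis unfolding lhs rhs' down using up[of _ h "d - 1"] IH[of "d + 1"] by simp
  qed
  then show ?case by (simp add: G_def)
qed

text \<open>Descents of the two-row tableau: an entry is in the second row and its predecessor in
  the first. With the newest step at the head the layout is that of \<open>inv_descents\<close>,
  including the \<open>False\<close> for the smallest entry.\<close>

fun descs :: "bool list \<Rightarrow> bool list" where
  "descs [] = []"
| "descs [x] = [False]"
| "descs (x # y # r) = (\<not> x \<and> y) # descs (y # r)"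

lemma length_descs [simp]: "length (descs r) = length r"
  by (induction r rule: descs.induct) auto

lemma descs_tl: "descs (tl r) = tl (descs r)"
  by (cases r rule: descs.cases) auto

lemma descs_True: "descs (True # r) = False # descs r"
  by (cases r) auto

text \<open>Words are stored backwards, so the down step is written in front of the up step, and
  \<open>j\<close> counts the steps that come after the peak in time.\<close>

definition peak :: "nat \<Rightarrow> bool list \<Rightarrow> bool list" where
  "peak j r = take j r @ [False, True] @ drop j r"

lemma peak_0 [simp]: "peak 0 r = False # True # r"
  by (simp add: peak_def)

lemma peak_Suc [simp]: "peak (Suc j) (x # r) = x # peak j r"
  by (simp add: peak_def)

lemma ok321_0 [simp]: "ok321 0 bs" "ok321 (Suc 0) bs"
  by (simp_all add: ok321_def)

lemma ok321_Suc_Suc [simp]: "ok321 (Suc (Suc j)) (b # bs) \<longleftrightarrow> \<not> b \<and> ok321 (Suc j) bs"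
  by (simp add: ok321_def)

lemma ok321_Cons: "ok321 (Suc j) (b # bs) \<Longrightarrow> ok321 j bs"
  by (cases j) auto

text \<open>Here \<open>x\<close> is the last step, which is lost. This does not show: its bit is
  \<open>False\<close> by \<open>ok321\<close>, the other later steps carry no peak either, and a
  down step inserted before them creates none. The new peak gives \<open>True\<close>, its up step
  gives \<open>False\<close>, and the older bits are kept.\<close>

lemma descs_peak_aux:
  "i \<le> length r \<Longrightarrow> ok321 (Suc i) (descs (x # r)) \<Longrightarrow>
   descs (peak i r) = take i (descs (x # r)) @ [True, False] @ drop (Suc i) (descs (x # r))"
proof (induction i arbitrary: x r)
  case 0
  then show ?case using descs_tl[of "x # r"] by (simp add: descs_True drop_Suc)
next
  case (Suc i)
  then obtain y q where r: "r = y # q" by (cases r) auto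
  have "\<not> (\<not> y \<and> hd (peak i q))"
    using Suc.prems by (cases i; cases q) (auto simp: r)
  moreover have "peak i q \<noteq> []" by (simp add: peak_def)
  ultimately have "descs (peak (Suc i) r) = False # descs (peak i q)"
    by (cases "peak i q") (auto simp: r)
  then show ?case using Suc by (simp add: r)
qed

text \<open>The word gains two steps but the permutation only one entry, so the last step is
  dropped. For \<open>j = 0\<close> that is the down step of the peak itself, and a new final up
  step remains.\<close>

lemma descs_peak:
  assumes "j \<le> length r" "ok321 j (descs r)"
  shows "descs (tl (peak j r)) = insert_level j (descs r)"
proof (cases j)
  case (Suc i)
  then obtain x q where "r = x # q" using assms by (cases r) auto
  then show ?thesis using assms Suc descs_peak_aux[of i q x] by (simp add: insert_level_def)
qed (simp add: insert_level_def descs_True)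

lemma length_peak [simp]: "length (peak j r) = length r + 2"
  by (simp add: peak_def)

lemma height_append: "height (xs @ ys) = height xs + height ys"
  by (induction xs) auto

lemma height_peak [simp]: "height (peak j r) = height r"
  using height_append[of "take j r" "drop j r"] by (simp add: peak_def height_append)

lemma ballot_peak [simp]: "ballot (peak j r) = ballot r"
proof (induction j arbitrary: r)
  case 0
  then show ?case using ballot_height_nonneg by (auto simp: add_nonneg_nonneg)
next
  case (Suc j)
  then show ?case
  proof (cases r)
    case Nil
    then show ?thesis by (simp add: peak_def)
  qed simp
qed

lemma peak_inj:
  assumes "peak i q = peak j r" "i \<le> length q" "j \<le> length r" "ok321 i (descs q)" "ok321 j (descs r)"
  shows "i = j \<and> q = r"
proof -
  \<comment> \<open>A word ending in a peak has its last peak there, whereas \<open>ok321\<close>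
    makes the inserted peak the last one.\<close>
  have zero: False if "False # True # p = peak (Suc i) q" "Suc i \<le> length q" "ok321 (Suc i) (descs q)" for p i q
    using that by (cases q rule: descs.cases; cases i) auto
  show ?thesis using assms
  proof (induction i arbitrary: j q r)
    case 0
    then show ?case using zero by (cases j) auto
  next
    case (Suc i)
    show ?case
    proof (cases j)
      case 0
      then show ?thesis using zero Suc.prems by (metis peak_0)
    next
      case j: (Suc k)
      then obtain x q' y r' where qr: "q = x # q'" "r = y # r'"
        using Suc.prems by (cases q; cases r) auto
      have "ok321 i (descs q')" "ok321 k (descs r')"
        using Suc.prems(4,5) j qr descs_tl[of q] descs_tl[of r] ok321_Cons
        by (metis length_descs length_Cons list.collapse list.sel(3) list.size(3) nat.distinct(1))+
      then show ?thesis using Suc.IH[of q' k r'] Suc.prems j qr by auto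
    qed
  qed
qed

text \<open>The height is below the length, so there is a down step, and in a ballot word some down
  step directly follows an up step. The search runs from the newest step back to the last such
  place.\<close>

lemma peak_exists:
  "ballot s \<Longrightarrow> height s < int (length s) \<Longrightarrow> \<exists>j r. s = peak j r \<and> j \<le> length r \<and> ok321 j (descs r)"
proof (induction s)
  case (Cons x s)
  show ?case
  proof (cases x)
    case True
    then obtain j r where s: "s = peak j r" "j \<le> length r" "ok321 j (descs r)"
      using Cons by auto
    then have "ok321 (Suc j) (descs (True # r))" by (cases j) (auto simp: descs_True)
    then show ?thesis using s True by (intro exI[of _ "Suc j"] exI[of _ "True # r"]) auto
  next
    case False
    show ?thesis
    proof (cases s)
      case Nil
      then show ?thesis using Cons.prems False by simp
    next
      case s: (Cons y t)
      show ?thesis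
      proof (cases y)
        case True
        then show ?thesis using s False by (intro exI[of _ 0] exI[of _ t]) auto
      next
        case y: False
        then have "height s < int (length s)" using s height_le_length[of t] by simp
        then obtain j r where p: "s = peak j r" "j \<le> length r" "ok321 j (descs r)"
          using Cons by auto
        have "ok321 (Suc j) (descs (False # r))"
        proof (cases j)
          case (Suc i)
          then obtain z q where "r = z # q" using p by (cases r) auto
          then show ?thesis using p s y Suc by auto
        qed simp
        then show ?thesis using p False by (intro exI[of _ "Suc j"] exI[of _ "False # r"]) auto
      qed
    qed
  qed
qed simp

lemma sum_last_peak:
  assumes "d \<le> int h"
  shows "(\<Sum>r\<in>words h d. \<Sum>j\<in>{j \<in> {..h}. ok321 j (descs r)}. f (peak j r)) = (\<Sum>s\<in>words (h + 2) d. f s)"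
proof -
  let ?D = "Sigma (words h d) (\<lambda>r. {j \<in> {..h}. ok321 j (descs r)})"
  have "bij_betw (\<lambda>(r, j). peak j r) ?D (words (h + 2) d)"
    unfolding bij_betw_def
  proof
    show "inj_on (\<lambda>(r, j). peak j r) ?D"
      using peak_inj by (fastforce simp: inj_on_def words_def)
    show "(\<lambda>(r, j). peak j r) ` ?D = words (h + 2) d"
    proof (intro equalityI subsetI)
      fix s assume s: "s \<in> words (h + 2) d"
      then obtain j r where p: "s = peak j r" "j \<le> length r" "ok321 j (descs r)"
        using peak_exists[of s] assms by (auto simp: words_def)
      with s have "(r, j) \<in> ?D" by (auto simp: words_def)
      with p show "s \<in> (\<lambda>(r, j). peak j r) ` ?D" by force
    qed (auto simp: words_def)
  qed
  then have "(\<Sum>s\<in>words (h + 2) d. f s) = (\<Sum>(r, j)\<in>?D. f (peak j r))"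
    by (simp add: sum.reindex_bij_betw[symmetric] case_prod_unfold)
  then show ?thesis by (simp add: sum.Sigma)
qed

section \<open>The common recursion on shapes and its unique solution\<close>

lemma sum_words_tl_cong:
  assumes "\<And>d. (\<Sum>r\<in>words h d. f r) = (\<Sum>r\<in>words h d. g r)"
  shows "(\<Sum>r\<in>words (Suc h) d. f (tl r)) = (\<Sum>r\<in>words (Suc h) d. g (tl r))"
proof (cases "d \<ge> 0")
  case True
  then show ?thesis using assms by (simp add: sum_words_Suc)
qed (simp add: words_neg)

text \<open>Without their last steps, the words of length \<open>h + 2\<close> and height
  \<open>d\<close> are those of length \<open>h + 1\<close> and heights \<open>d - 1\<close> and
  \<open>d + 1\<close>: the tableaux with one more box in either row. Hence every term on the right
  is a combination of sums over whole shapes, with smaller \<open>m\<close> or shorter words, and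
  induction on \<open>m\<close> and then on \<open>h\<close> applies.\<close>

lemma word_sums_unique:
  fixes F G :: "nat \<Rightarrow> bool list \<Rightarrow> int"
  assumes rec: "\<And>H m h d. H \<in> {F, G} \<Longrightarrow> 0 \<le> d \<Longrightarrow> d \<le> int h \<Longrightarrow>
      (\<Sum>r\<in>words h d. H (Suc m) r) =
      (if h = 0 then 0 else \<Sum>r\<in>words h d. H (Suc m) (tl r)) +
      (\<Sum>r\<in>words (h + 2) d. H m (tl r) - H m (tl (tl r))) + (\<Sum>r\<in>words h d. H m r)"
    and zero: "\<And>r. F 0 r = G 0 r"
  shows "(\<Sum>r\<in>words h d. F m r) = (\<Sum>r\<in>words h d. G m r)"
proof (induction m arbitrary: h d)
  case (Suc m)
  note m = Suc.IH
  have tl1: "(\<Sum>r\<in>words (h + 2) d. F m (tl r)) = (\<Sum>r\<in>words (h + 2) d. G m (tl r))" for h d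
    using sum_words_tl_cong[of "F m" "Suc h" "G m" d] m by simp
  have tl2: "(\<Sum>r\<in>words (h + 2) d. F m (tl (tl r))) = (\<Sum>r\<in>words (h + 2) d. G m (tl (tl r)))" for h d
    using sum_words_tl_cong[of "\<lambda>r. F m (tl r)" "Suc h" "\<lambda>r. G m (tl r)" d]
      sum_words_tl_cong[of "F m" h "G m"] m by simp
  show ?case
  proof (induction h arbitrary: d)
    case 0
    show ?case
    proof (cases "d = 0")
      case True
      then show ?thesis using rec[where H = F and d = d and h = 0 and m = m] rec[where H = G and d = d and h = 0 and m = m] tl1[where d = d and h = 0] tl2[where d = d and h = 0] m[where d = d and h = 0]
        by (simp add: sum_subtractf)
    qed (simp add: words_0)
  next
    case (Suc k)
    show ?case
    proof (cases "0 \<le> d \<and> d \<le> int (Suc k)")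
      case True
      then show ?thesis
        using rec[where H = F and d = d and h = "Suc k" and m = m] rec[where H = G and d = d and h = "Suc k" and m = m] tl1[where d = d and h = "Suc k"] tl2[where d = d and h = "Suc k"] m[where d = d and h = "Suc k"]
          sum_words_tl_cong[of "F (Suc m)" k "G (Suc m)" d, OF Suc.IH]
        by (simp add: sum_subtractf)
    next
      case False
      then consider "d < 0" | "d > int (Suc k)" by linarith
      then show ?thesis by cases (simp_all add: words_neg words_gt)
    qed
  qed
qed (simp add: zero)

lemma ext_desc_rec:
  assumes "0 \<le> d" "d \<le> int h"
  shows "(\<Sum>r\<in>words h d. ext_desc ok321 (Suc m) (descs r)) =
    (if h = 0 then 0 else \<Sum>r\<in>words h d. ext_desc ok321 (Suc m) (descs (tl r))) +
    (\<Sum>r\<in>words (h + 2) d. ext_desc ok321 m (descs (tl r)) - ext_desc ok321 m (descs (tl (tl r)))) +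
    (\<Sum>r\<in>words h d. ext_desc ok321 m (descs r))"
proof -
  let ?E = "ext_desc ok321"
  have "?E (Suc m) (descs r) = (if h = 0 then 0 else ?E (Suc m) (descs (tl r))) +
      (\<Sum>j\<in>{j \<in> {..h}. ok321 j (descs r)}. ?E m (descs (tl (peak j r))) - ?E m (descs (tl (tl (peak j r))))) +
      ?E m (descs r)" if "r \<in> words h d" for r
  proof -
    have len: "length r = h" using that by (simp add: words_def)
    have "(descs r = []) = (h = 0)" using len by (metis length_0_conv length_descs)
    moreover have "(\<Sum>j\<in>{j \<in> {..h}. ok321 j (descs r)}. ?E m (descs (tl (peak j r))) - ?E m (descs (tl (tl (peak j r))))) =
      (\<Sum>j\<in>{j \<in> {..h}. ok321 j (descs r)}. ?E m (insert_level j (descs r)) - ?E m (tl (insert_level j (descs r))))"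
      using len by (intro sum.cong) (auto simp: descs_peak descs_tl[of "tl _"])
    ultimately show ?thesis
      by (subst ext_desc.simps(2)) (simp add: descs_tl len)
  qed
  then have "(\<Sum>r\<in>words h d. ?E (Suc m) (descs r)) = (\<Sum>r\<in>words h d. (if h = 0 then 0 else ?E (Suc m) (descs (tl r))) +
      (\<Sum>j\<in>{j \<in> {..h}. ok321 j (descs r)}. ?E m (descs (tl (peak j r))) - ?E m (descs (tl (tl (peak j r))))) +
      ?E m (descs r))"
    by (intro sum.cong) auto
  then show ?thesis
    using sum_last_peak[OF assms(2), of "\<lambda>s. ?E m (descs (tl s)) - ?E m (descs (tl (tl s)))"]
    by (simp add: sum.distrib)
qed

lemma ext_lead_rec:
  assumes "0 \<le> d" "d \<le> int h"
  shows "(\<Sum>r\<in>words h d. ext_lead (Suc m) (length r) (ups r)) =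
    (if h = 0 then 0 else \<Sum>r\<in>words h d. ext_lead (Suc m) (length (tl r)) (ups (tl r))) +
    (\<Sum>r\<in>words (h + 2) d. ext_lead m (length (tl r)) (ups (tl r)) -
        ext_lead m (length (tl (tl r))) (ups (tl (tl r)))) +
    (\<Sum>r\<in>words h d. ext_lead m (length r) (ups r))"
proof -
  let ?g = "\<lambda>i. ext_lead m (Suc h) i - ext_lead m h (min i h)"
  have "ext_lead (Suc m) (length r) (ups r) =
      (if h = 0 then 0 else ext_lead (Suc m) (length (tl r)) (ups (tl r))) +
      (\<Sum>i\<in>{1..Suc (ups r)}. ?g i) + ext_lead m (length r) (ups r)" if "r \<in> words h d" for r
  proof -
    have len: "length r = h" using that by (simp add: words_def)
    then show ?thesis
      using ups_tl[of r] by (subst ext_lead.simps(2)) (auto simp del: sum.cl_ivl_Suc)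
  qed
  then have "(\<Sum>r\<in>words h d. ext_lead (Suc m) (length r) (ups r)) =
      (\<Sum>r\<in>words h d. (if h = 0 then 0 else ext_lead (Suc m) (length (tl r)) (ups (tl r))) +
      (\<Sum>i\<in>{1..Suc (ups r)}. ?g i) + ext_lead m (length r) (ups r))"
    by (intro sum.cong) auto
  \<comment> \<open>A word with a down step keeps its initial run when its last step is dropped;
    dropping another step cuts the run at \<open>h\<close>, which is the \<open>min i h\<close> of
    \<open>ext_lead\<close>.\<close>
  moreover have "?g (ups r) = ext_lead m (length (tl r)) (ups (tl r)) -
        ext_lead m (length (tl (tl r))) (ups (tl (tl r)))" if "r \<in> words (h + 2) d" for r
  proof -
    have len: "length r = h + 2" using that by (simp add: words_def)
    have "r \<noteq> []" "tl r \<noteq> []" using len by (auto simp flip: length_0_conv)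
    moreover have "ups r < h + 2" using ups_less[OF that] assms by simp
    ultimately show ?thesis using len by (simp add: ups_tl)
  qed
  ultimately show ?thesis
    using sum_first_peak[OF assms, of ?g] by (simp add: sum.distrib del: sum.cl_ivl_Suc)
qed

lemma ext_desc_ok321_eq_ext_lead: "ext_desc ok321 m [] = ext_lead m 0 0"
proof -
  have "(\<Sum>r\<in>words 0 0. ext_desc ok321 m (descs r)) = (\<Sum>r\<in>words 0 0. ext_lead m (length r) (ups r))"
    by (rule word_sums_unique[where F = "\<lambda>m r. ext_desc ok321 m (descs r)" and
        G = "\<lambda>m r. ext_lead m (length r) (ups r)"])
      (use ext_desc_rec ext_lead_rec in auto)
  then show ?thesis by (simp add: words_0)
qed

lemma wilf_1234_3214:
  "card {xs \<in> perms n. av31 (<) xs} = card {xs \<in> perms n. av31 (>) xs}"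
proof -
  have nil: "[] \<in> perms 0" "av3 R []" "inv_descents [] = []" for R
    by (simp_all add: av3_def inv_descents_def)
  have "int (card {xs \<in> perms n. av31 (>) xs}) = ext_desc ok321 n []"
    using card_av31[of "(>)" n] extensions_eq_ext_desc[of "(>)" ok321 "[]" 0 n] ok321_iff nil by simp
  also have "\<dots> = ext_desc ok123 n []"
    using ext_desc_ok321_eq_ext_lead[of n] ext_desc_eq_ext_lead[of "[]" n] by (simp add: lead_def)
  also have "\<dots> = int (card {xs \<in> perms n. av31 (<) xs})"
    using card_av31[of "(<)" n] extensions_eq_ext_desc[of "(<)" ok123 "[]" 0 n] ok123_iff nil by simp
  finally show ?thesis by simp
qed

subsection \<open>Catalan numbers\<close>

text \<open>
  A \<open>321\<close>-avoider whose label is \<open>k\<close> has the \<open>k + 1\<close> children with labels \<open>1, \<dots>, k + 1\<close> in the generating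
  tree.
\<close>

primrec descendants :: "nat \<Rightarrow> nat \<Rightarrow> nat" where
  "descendants 0 k = 1"
| "descendants (Suc m) k = (\<Sum>j\<in>{1..Suc k}. descendants m j)"

definition children :: "bool list \<Rightarrow> nat" where
  "children bs = min (length bs) (Suc (length (takeWhile Not bs)))"

lemma ok321_iff_children:
  assumes "j \<le> length bs"
  shows "ok321 j bs \<longleftrightarrow> j \<le> children bs"
proof (cases j)
  case (Suc i)
  then have "ok321 j bs \<longleftrightarrow> i \<le> length (takeWhile Not bs)"
    using assms by (simp add: ok321_def list_all_take_iff)
  then show ?thesis using assms Suc by (simp add: children_def)
qed (simp add: ok321_def)

text \<open>Level \<open>j \<ge> 1\<close> places the first \<open>True\<close> at index
  \<open>j - 1\<close>, which makes the label \<open>j\<close>; level 0 prepends a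
  \<open>False\<close> and raises the label by one.\<close>

lemma children_insert_level:
  assumes "j \<le> children bs"
  shows "children (insert_level j bs) = (if j = 0 then Suc (children bs) else j)"
proof (cases j)
  case (Suc i)
  then have i: "i \<le> length (takeWhile Not bs)" "j \<le> length bs" using assms by (auto simp: children_def)
  then have "list_all Not (take i bs)"
    using list_all_take_iff[of i bs Not] Suc by simp
  then have "takeWhile Not (take i bs @ True # zs) = take i bs" for zs
    by (subst takeWhile_append2) (auto simp: list_all_iff)
  then show ?thesis using i Suc by (simp add: children_def insert_level_def)
qed (simp add: children_def insert_level_def)

lemma card_av321: "card {xs \<in> perms n. av3 (>) xs} = descendants n 0"
proof -
  let ?N = "\<lambda>n. {xs \<in> perms n. av3 (>) xs}"
  let ?c = "\<lambda>xs. children (inv_descents xs)"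
  have step: "(\<Sum>xs\<in>?N (Suc n). descendants m (?c xs)) = (\<Sum>xs\<in>?N n. descendants (Suc m) (?c xs))" for n m
  proof -
    have "(\<Sum>xs\<in>?N (Suc n). descendants m (?c xs)) =
      (\<Sum>xs\<in>?N n. \<Sum>a\<in>{a \<in> {1..Suc n}. av3 (>) (append_rank a xs)}. descendants m (?c (append_rank a xs)))"
      by (rule sum_append_rank) (auto simp: av3_append_rank)
    also have "\<dots> = (\<Sum>xs\<in>?N n. descendants (Suc m) (?c xs))"
    proof (rule sum.cong[OF refl])
      fix xs assume "xs \<in> ?N n"
      then have xs: "xs \<in> perms n" "av3 (>) xs" by auto
      let ?k = "?c xs"
      have k: "?k \<le> n" using perms_length[OF xs(1)] by (simp add: children_def)
      have "(\<Sum>a\<in>{a \<in> {1..Suc n}. av3 (>) (append_rank a xs)}. descendants m (?c (append_rank a xs))) =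
          (\<Sum>j\<in>{0..?k}. descendants m (if j = 0 then Suc ?k else j))"
      proof (rule sum.reindex_bij_witness[of _ "\<lambda>j. Suc n - j" "\<lambda>a. Suc n - a"])
        fix a assume a: "a \<in> {a \<in> {1..Suc n}. av3 (>) (append_rank a xs)}"
        then have a': "a \<in> {1..Suc n}" by blast
        have j: "Suc n - a \<le> ?k"
          using a ok321_iff[OF xs(1) a' xs(2)] ok321_iff_children[of "Suc n - a" "inv_descents xs"]
          by (auto simp: perms_length[OF xs(1)])
        then show "Suc n - a \<in> {0..?k}" by simp
        show "descendants m (if Suc n - a = 0 then Suc ?k else Suc n - a) = descendants m (?c (append_rank a xs))"
          using children_insert_level[OF j] by (simp add: inv_descents_append_rank[OF xs(1) a'])
      next
        fix j assume j: "j \<in> {0..?k}"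
        then have a: "Suc n - j \<in> {1..Suc n}" "Suc n - (Suc n - j) = j" using k by auto
        then show "Suc n - j \<in> {a \<in> {1..Suc n}. av3 (>) (append_rank a xs)}"
          using j k ok321_iff[OF xs(1) a(1) xs(2)] ok321_iff_children[of j "inv_descents xs"]
          by (simp add: perms_length[OF xs(1)])
      qed (use k in auto)
      also have "\<dots> = descendants m (Suc ?k) + (\<Sum>j\<in>{1..?k}. descendants m (if j = 0 then Suc ?k else j))"
        by (simp add: sum.atLeast_Suc_atMost)
      also have "(\<Sum>j\<in>{1..?k}. descendants m (if j = 0 then Suc ?k else j)) = (\<Sum>j\<in>{1..?k}. descendants m j)"
        by (intro sum.cong) auto
      finally show "(\<Sum>a\<in>{a \<in> {1..Suc n}. av3 (>) (append_rank a xs)}. descendants m (?c (append_rank a xs))) =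
          descendants (Suc m) ?k" by simp
    qed
    finally show ?thesis .
  qed
  have "(\<Sum>xs\<in>?N n. descendants m (?c xs)) = (\<Sum>xs\<in>?N 0. descendants (m + n) (?c xs))" for m
  proof (induction n arbitrary: m)
    case (Suc n)
    show ?case using step[of m n] Suc.IH[of "Suc m"] by (simp del: descendants.simps)
  qed simp
  from this[of 0] show ?thesis
    by (simp add: av3_def Collect_conv_if inv_descents_def children_def)
qed

text \<open>Ballot numbers in the form of the reflection principle; \<open>Suc p\<close> keeps the
  lower index of the second binomial natural. Raising the label adds a single child, so the step in
  \<open>k\<close> is Pascal's rule.\<close>

lemma descendants_Suc_binomial:
  "int (descendants (Suc p) k) = int ((2 * p + 2 + k) choose Suc p) - int ((2 * p + 2 + k) choose p)"
proof (induction p arbitrary: k)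
  case 0
  then show ?case by simp
next
  case (Suc p)
  note p = Suc.IH
  show ?case
  proof (induction k)
    case 0
    have sym: "(2 * p + 3) choose (p + 2) = (2 * p + 3) choose (p + 1)"
      using binomial_symmetric[of "p + 1" "2 * p + 3"] by simp
    have "descendants (Suc (Suc p)) 0 = descendants (Suc p) 1" by (simp del: descendants.simps add: descendants.simps(2)[of "Suc p"])
    then show ?case using p[of 1] sym
      by (simp add: eval_nat_numeral del: descendants.simps)
  next
    case (Suc k)
    have "descendants (Suc (Suc p)) (Suc k) = descendants (Suc (Suc p)) k + descendants (Suc p) (Suc (Suc k))"
      by (simp del: descendants.simps add: descendants.simps(2)[of "Suc p"])
    then show ?case using Suc.IH p[of "Suc (Suc k)"]
      by (simp add: eval_nat_numeral del: descendants.simps)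
  qed
qed

lemma descendants_0_catalan: "real (descendants n 0) = catalan n"
proof (cases n)
  case (Suc p)
  have "real (descendants n 0) = real ((2 * n) choose n) - real ((2 * n) choose p)"
    using arg_cong[OF descendants_Suc_binomial[of p 0], of real_of_int] Suc
    by (simp del: descendants.simps)
  moreover have "real (2 * n choose p) * real (n + 1) = real (2 * n choose n) * real n"
  proof -
    have "(2 * n choose p) * (2 * n - p) = (2 * n choose Suc p) * Suc p"
      using binomial_absorb_comp[of "2 * n" p] binomial_absorption[of p "2 * n"]
      by (metis mult.commute)
    moreover have "2 * n - p = n + 1" using Suc by simp
    ultimately show ?thesis using Suc by (metis of_nat_mult)
  qed
  ultimately have "real (descendants n 0) * real (n + 1) = real (2 * n choose n)"
    by (simp add: left_diff_distrib) (simp add: distrib_left)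
  then show ?thesis by (simp add: catalan_def field_simps)
qed (simp add: catalan_def)

section \<open>The Catalan series and the square root of 1 - 4x\<close>

lemma catalan_0: "catalan 0 = 1"
  by (simp add: catalan_def)

lemma catalan_Suc: "real (k + 2) * catalan (Suc k) = real (4 * k + 2) * catalan k"
proof -
  have 1: "Suc k * (2 * k + 2 choose Suc k) = (2 * k + 2) * (2 * k + 1 choose k)"
    using Suc_times_binomial_eq[of "2 * k + 1" k] by (simp add: mult.commute)
  have 2: "Suc k * (2 * k + 1 choose Suc k) = (2 * k + 1) * (2 * k choose k)"
    using Suc_times_binomial_eq[of "2 * k" k] by (simp add: mult.commute)
  have 3: "(2 * k + 1 choose Suc k) = (2 * k + 1 choose k)"
    using binomial_symmetric[of k "2 * k + 1"] by simp
  have "(2 * k + 2) * X = (4 * k + 2) * Y" if "Suc k * X = (2 * k + 1) * Y" for X Y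
    using that by (simp add: algebra_simps)
  then have "Suc k * (2 * k + 2 choose Suc k) = (4 * k + 2) * (2 * k choose k)"
    unfolding 1 using 2 unfolding 3 by blast
  then have "real (Suc k) * real (2 * k + 2 choose Suc k) = real (4 * k + 2) * real (2 * k choose k)"
    by (metis of_nat_mult)
  moreover have "real (k + 2) * catalan (Suc k) = real (2 * k + 2 choose Suc k)"
    by (simp add: catalan_def del: binomial_Suc_Suc)
  moreover have "real (2 * k choose k) = real (Suc k) * catalan k"
    by (simp add: catalan_def)
  ultimately have "real (Suc k) * (real (k + 2) * catalan (Suc k)) = real (Suc k) * (real (4 * k + 2) * catalan k)"
    by (simp only: mult.left_commute)
  then show ?thesis by (subst (asm) mult_cancel_left) simp
qed

definition catalan_fps :: "real fps" where
  "catalan_fps = Abs_fps catalan"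

text \<open>The two-term recurrence of the Catalan numbers says that \<open>D\<close> solves
  \<open>(1 - 4x) D' = -2 D\<close>. Then its square \<open>F\<close> solves
  \<open>(1 - 4x) F' = -4 F\<close>, which determines \<open>F\<close> from its constant
  term.\<close>

lemma sqrt_catalan: "(1 - 2 * fps_X * catalan_fps)\<^sup>2 = 1 - 4 * fps_X"
proof -
  define D :: "real fps" where "D = 1 - 2 * fps_X * catalan_fps"
  define F :: "real fps" where "F = D\<^sup>2"
  have D0: "fps_nth D 0 = 1" by (simp add: D_def)
  have DS: "fps_nth D (Suc n) = - 2 * catalan n" for n
    by (simp add: D_def catalan_fps_def mult.assoc fps_numeral_nth numeral_fps_const)
  have ode: "(1 - 4 * fps_X) * fps_deriv D = - 2 * D"
  proof (rule fps_ext)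
    fix n
    have "fps_nth ((1 - 4 * fps_X) * fps_deriv D) n =
        real (n + 1) * fps_nth D (n + 1) - 4 * real n * fps_nth D n"
      by (cases n) (simp_all add: left_diff_distrib mult.assoc numeral_fps_const)
    also have "\<dots> = - 2 * fps_nth D n"
    proof (cases n)
      case 0
      then show ?thesis by (simp add: DS D0 catalan_0)
    next
      case (Suc k)
      then show ?thesis using catalan_Suc[of k] by (simp add: DS algebra_simps)
    qed
    also have "\<dots> = fps_nth (- 2 * D) n" by (simp add: numeral_fps_const)
    finally show "fps_nth ((1 - 4 * fps_X) * fps_deriv D) n = fps_nth (- 2 * D) n" .
  qed
  have "(1 - 4 * fps_X) * fps_deriv F = 2 * D * ((1 - 4 * fps_X) * fps_deriv D)"
    by (simp add: F_def power2_eq_square algebra_simps)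
  also have "\<dots> = - 4 * F" unfolding ode by (simp add: F_def power2_eq_square)
  finally have odeF: "(1 - 4 * fps_X) * fps_deriv F = - 4 * F" .
  have rec: "real (n + 1) * fps_nth F (n + 1) = (4 * real n - 4) * fps_nth F n" for n
  proof -
    have "fps_nth ((1 - 4 * fps_X) * fps_deriv F) n =
        real (n + 1) * fps_nth F (n + 1) - 4 * real n * fps_nth F n"
      by (cases n) (simp_all add: left_diff_distrib mult.assoc numeral_fps_const)
    moreover have "fps_nth (- 4 * F) n = - 4 * fps_nth F n" by (simp add: numeral_fps_const)
    ultimately show ?thesis unfolding odeF by (simp add: algebra_simps)
  qed
  have F0: "fps_nth F 0 = 1" by (simp add: F_def D0 power2_eq_square)
  have F1: "fps_nth F 1 = - 4" using rec[of 0] F0 by simp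
  \<comment> \<open>The factor \<open>4 n - 4\<close> vanishes at \<open>n = 1\<close> and ends the
    series after the linear term.\<close>
  have F2: "fps_nth F (Suc (Suc n)) = 0" for n
  proof (induction n)
    case 0
    then show ?case using rec[of 1] by simp
  next
    case (Suc n)
    then show ?case using rec[of "Suc (Suc n)"] by simp
  qed
  have "F = 1 - 4 * fps_X"
  proof (rule fps_ext)
    fix n
    consider "n = 0" | "n = 1" | k where "n = Suc (Suc k)" by (metis One_nat_def not0_implies_Suc)
    then show "fps_nth F n = fps_nth (1 - 4 * fps_X) n"
      using F0 F1 F2 by cases (simp_all add: numeral_fps_const)
  qed
  then show ?thesis by (simp add: F_def D_def)
qed

text \<open>Of the two square roots, \<open>fps_radical root 2\<close> is the one with constant term
  \<open>root 2 1 = 1\<close>.\<close>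

lemma fps_radical_catalan: "fps_radical root 2 (1 - 4 * fps_X) = 1 - 2 * fps_X * catalan_fps"
proof -
  have "(1 - 2 * fps_X * catalan_fps) ^ Suc 1 = 1 - 4 * fps_X"
    using sqrt_catalan by (simp add: numeral_2_eq_2)
  then show ?thesis
    using radical_unique[of root 1 "1 - 4 * fps_X" "1 - 2 * fps_X * catalan_fps"]
    by (simp add: numeral_2_eq_2 del: power_Suc)
qed

text \<open>Expanding the square in \<open>sqrt_catalan\<close> and cancelling
  \<open>4 * fps_X\<close> gives the convolution identity.\<close>

lemma catalan_fps_eq: "catalan_fps = 1 + fps_X * catalan_fps\<^sup>2"
proof -
  have "4 * fps_X * catalan_fps = 4 * fps_X * (1 + fps_X * catalan_fps\<^sup>2)"
    using sqrt_catalan by (simp add: power2_eq_square algebra_simps)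
  moreover have "4 * fps_X \<noteq> (0 :: real fps)" by simp
  ultimately show ?thesis by (metis mult_cancel_left)
qed

subsection \<open>Direct sums\<close>

definition direct_sum :: "nat list \<Rightarrow> nat list \<Rightarrow> nat list" where
  "direct_sum xs ys = xs @ map (\<lambda>v. v + length xs) ys"

definition indec :: "nat \<Rightarrow> nat list set" where
  "indec k = {xs \<in> perms k. indecomposable xs}"

lemma finite_indec [simp]: "finite (indec k)"
  by (simp add: indec_def)

lemma first_component_props:
  assumes "xs \<in> perms n" "n \<ge> 1"
  shows "1 \<le> first_component xs" "first_component xs \<le> n"
    "set (take (first_component xs) xs) = {1..first_component xs}"
proof -
  have n: "1 \<le> n \<and> set (take n xs) = {1..n}"
    using assms perms_length[OF assms(1)] by (simp add: perms_iff)
  show "1 \<le> first_component xs" "set (take (first_component xs) xs) = {1..first_component xs}"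
    using LeastI[of "\<lambda>i. 1 \<le> i \<and> set (take i xs) = {1..i}", OF n] by (auto simp: first_component_def)
  show "first_component xs \<le> n"
    unfolding first_component_def using n by (rule Least_le)
qed

lemma first_component_append:
  assumes "xs \<in> perms k" "k \<ge> 1"
  shows "first_component (xs @ ys) = first_component xs"
proof -
  let ?P = "\<lambda>zs i. 1 \<le> i \<and> set (take i zs) = {1..i}"
  have len: "length xs = k" using assms(1) by (rule perms_length)
  let ?i = "first_component xs"
  note i = first_component_props[OF assms]
  show ?thesis unfolding first_component_def[of "xs @ ys"]
  proof (rule Least_equality)
    show "?P (xs @ ys) ?i" using i len by simp
  next
    fix j assume j: "?P (xs @ ys) j"
    show "?i \<le> j"
    proof (cases "j \<le> k")
      case True
      then have "?P xs j" using j len by simp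
      then show ?thesis unfolding first_component_def by (rule Least_le)
    qed (use i in simp)
  qed
qed

lemma direct_sum_perms:
  assumes "xs \<in> perms k" "ys \<in> perms m"
  shows "direct_sum xs ys \<in> perms (k + m)"
proof -
  have "(\<lambda>v. v + k) ` {1..m} = {Suc k..k + m}"
    by (simp add: image_add_atLeastAtMost' add.commute)
  then show ?thesis
    using assms perms_length[OF assms(1)]
    by (auto simp: perms_iff direct_sum_def distinct_map inj_on_def)
qed

lemma direct_sum_exists:
  assumes "zs \<in> perms n" "n \<ge> 1"
  shows "\<exists>k xs ys. k \<in> {1..n} \<and> xs \<in> indec k \<and> ys \<in> perms (n - k) \<and> zs = direct_sum xs ys"
proof -
  define k where "k = first_component zs"
  note k = first_component_props[OF assms, folded k_def]
  have len: "length zs = n" using assms(1) by (rule perms_length)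
  define xs where "xs = take k zs"
  define ys where "ys = map (\<lambda>v. v - k) (drop k zs)"
  have d: "distinct zs" and s: "set zs = {1..n}" using assms by (auto simp: perms_iff)
  have zs: "zs = xs @ drop k zs" by (simp add: xs_def)
  have lx: "length xs = k" using k len by (simp add: xs_def)
  have xs: "xs \<in> perms k" using d k by (simp add: perms_iff xs_def)
  have sd: "set (drop k zs) = {Suc k..n}"
  proof -
    have "set (drop k zs) = set zs - set xs"
      using d set_append[of xs "drop k zs"] distinct_append[of xs "drop k zs"] zs by auto
    then show ?thesis using s xs by (auto simp: perms_iff)
  qed
  have "drop k zs = map (\<lambda>v. v + k) ys"
    unfolding ys_def map_map o_def using sd by (intro map_idI[symmetric]) auto
  then have "zs = direct_sum xs ys" using zs by (simp add: direct_sum_def lx)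
  moreover have "ys \<in> perms (n - k)"
  proof -
    have "set ys = (\<lambda>v. v - k) ` {Suc k..n}" using sd by (simp add: ys_def)
    also have "\<dots> = {1..n - k}"
    proof (intro equalityI subsetI)
      fix v assume "v \<in> {1..n - k}"
      then show "v \<in> (\<lambda>v. v - k) ` {Suc k..n}" by (intro image_eqI[of _ _ "v + k"]) auto
    qed auto
    finally have "set ys = {1..n - k}" .
    moreover have "distinct ys" using d sd by (auto simp: ys_def distinct_map inj_on_def)
    ultimately show ?thesis by (simp add: perms_iff)
  qed
  moreover have "xs \<in> indec k"
  proof -
    have "first_component xs = first_component zs"
      using first_component_append[OF xs k(1), of "drop k zs"] zs by simp
    then show ?thesis using xs lx k by (auto simp: indec_def indecomposable_def k_def)
  qed
  ultimately show ?thesis using k by auto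
qed

text \<open>The first component of the sum is all of the indecomposable summand, so the place of the
  cut is determined.\<close>

lemma direct_sum_inj:
  assumes "xs \<in> indec k" "xs' \<in> indec k'" "direct_sum xs ys = direct_sum xs' ys'"
  shows "k = k' \<and> xs = xs' \<and> ys = ys'"
proof -
  have len: "length xs = k" "length xs' = k'" using assms perms_length by (auto simp: indec_def)
  have "k \<ge> 1" "k' \<ge> 1" using assms len by (auto simp: indec_def indecomposable_def Suc_le_eq)
  then have "first_component (direct_sum xs ys) = k" "first_component (direct_sum xs' ys') = k'"
    using assms(1,2) len by (auto simp: direct_sum_def indec_def indecomposable_def first_component_append)
  then have "k = k'" using assms(3) by simp
  then have "xs = xs' \<and> map (\<lambda>v. v + k) ys = map (\<lambda>v. v + k) ys'"
    using assms(3) len by (simp add: direct_sum_def)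
  then show ?thesis using \<open>k = k'\<close> by (simp add: inj_map_eq_map)
qed

lemma sum_direct_sum:
  assumes "n \<ge> 1"
  shows "(\<Sum>zs\<in>perms n. f zs) =
    (\<Sum>k\<in>{1..n}. \<Sum>xs\<in>indec k. \<Sum>ys\<in>perms (n - k). f (direct_sum xs ys))"
proof -
  let ?D = "Sigma {1..n} (\<lambda>k. indec k \<times> perms (n - k))"
  have "bij_betw (\<lambda>(k, xs, ys). direct_sum xs ys) ?D (perms n)"
    unfolding bij_betw_def
  proof
    show "inj_on (\<lambda>(k, xs, ys). direct_sum xs ys) ?D"
    proof (rule inj_onI)
      fix p p' assume *: "p \<in> ?D" "p' \<in> ?D"
        "(\<lambda>(k, xs, ys). direct_sum xs ys) p = (\<lambda>(k, xs, ys). direct_sum xs ys) p'"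
      show "p = p'"
      proof (cases p; cases p')
        fix k xs ys k' xs' ys'
        assume "p = (k, xs, ys)" "p' = (k', xs', ys')"
        with * show ?thesis using direct_sum_inj[of xs k xs' k' ys ys'] by simp
      qed
    qed
    show "(\<lambda>(k, xs, ys). direct_sum xs ys) ` ?D = perms n"
    proof (intro equalityI subsetI)
      fix zs assume "zs \<in> perms n"
      then obtain k xs ys where "k \<in> {1..n}" "xs \<in> indec k" "ys \<in> perms (n - k)" "zs = direct_sum xs ys"
        using direct_sum_exists assms by blast
      then show "zs \<in> (\<lambda>(k, xs, ys). direct_sum xs ys) ` ?D"
        by (intro image_eqI[of _ _ "(k, xs, ys)"]) auto
    next
      fix zs assume "zs \<in> (\<lambda>(k, xs, ys). direct_sum xs ys) ` ?D"
      then obtain k xs ys where "k \<le> n" "xs \<in> perms k" "ys \<in> perms (n - k)" "zs = direct_sum xs ys"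
        by (auto simp: indec_def)
      then show "zs \<in> perms n" using direct_sum_perms[of xs k ys "n - k"] by simp
    qed
  qed
  then have "(\<Sum>zs\<in>perms n. f zs) = (\<Sum>(k, xs, ys)\<in>?D. f (direct_sum xs ys))"
    by (simp add: sum.reindex_bij_betw[symmetric] case_prod_unfold)
  then show ?thesis by (simp add: sum.Sigma sum.cartesian_product)
qed

lemma des_direct_sum:
  assumes "xs \<in> perms k"
  shows "des (direct_sum xs ys) = des xs + des ys"
proof -
  let ?zs = "direct_sum xs ys"
  have len: "length xs = k" using assms by (rule perms_length)
  let ?X = "{i. Suc i < length xs \<and> xs ! i > xs ! Suc i}"
  let ?Y = "{i. Suc i < length ys \<and> ys ! i > ys ! Suc i}"
  have iff: "Suc i < length ?zs \<and> ?zs ! i > ?zs ! Suc i \<longleftrightarrow>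
      i \<in> ?X \<or> i \<ge> k \<and> i - k \<in> ?Y" for i
  proof -
    consider "Suc i < k" | "Suc i = k" | "i \<ge> k" by linarith
    then show ?thesis
    proof cases
      \<comment> \<open>At the junction an entry of at most \<open>k\<close> is followed by one of
        at least \<open>k\<close>, so no descent arises there.\<close>
      case 2
      have "xs ! i \<le> k" using nth_mem[of i xs] 2 len assms by (auto simp: perms_iff)
      then show ?thesis using 2 len by (auto simp: direct_sum_def nth_append)
    next
      case 3
      then have "Suc i - k = Suc (i - k)" by simp
      then show ?thesis using 3 len by (auto simp: direct_sum_def nth_append)
    qed (auto simp: direct_sum_def nth_append len)
  qed
  have image: "i \<ge> k \<and> i - k \<in> Y \<longleftrightarrow> i \<in> (\<lambda>i. i + k) ` Y" for i Y
  proof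
    assume "i \<ge> k \<and> i - k \<in> Y"
    then show "i \<in> (\<lambda>i. i + k) ` Y" by (intro image_eqI[of _ _ "i - k"]) simp_all
  qed auto
  have "des ?zs = card (?X \<union> (\<lambda>i. i + k) ` ?Y)"
    unfolding des_def iff image by (simp only: Un_def mem_Collect_eq)
  also have "\<dots> = card ?X + card ((\<lambda>i. i + k) ` ?Y)"
  proof (rule card_Un_disjoint)
    have "?X \<subseteq> {..<length xs}" "?Y \<subseteq> {..<length ys}" by auto
    then show "finite ?X" "finite ((\<lambda>i. i + k) ` ?Y)" by (auto intro: finite_subset)
  qed (auto simp: len)
  also have "card ((\<lambda>i. i + k) ` ?Y) = card ?Y"
    by (intro card_image) (simp add: inj_on_def)
  finally show ?thesis by (simp add: des_def)
qed

section \<open>Pattern occurrences in direct sums\<close>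

lemma subseq_direct_sum:
  "subseq zs (direct_sum xs ys) \<longleftrightarrow>
    (\<exists>us vs. zs = us @ map (\<lambda>v. v + length xs) vs \<and> subseq us xs \<and> subseq vs ys)"
  unfolding direct_sum_def subseq_append_iff subseq_map_iff by blast

lemma subseqD: "subseq xs ys \<Longrightarrow> set xs \<subseteq> set ys"
  by (auto elim: list_emb_set)

lemma subseq_direct_sum_lower:
  assumes "subseq zs (direct_sum xs ys)" "ys \<in> perms m" "\<forall>z\<in>set zs. z \<le> length xs"
  shows "subseq zs xs"
proof -
  obtain us vs where uv: "zs = us @ map (\<lambda>v. v + length xs) vs" "subseq us xs" "subseq vs ys"
    using assms(1) unfolding subseq_direct_sum by blast
  have "vs = []"
  proof (rule ccontr)
    assume "vs \<noteq> []"
    then obtain v vs' where vs: "vs = v # vs'" by (cases vs) auto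
    then have "v \<ge> 1" using subseqD[OF uv(3)] assms(2) by (auto simp: perms_iff)
    then show False using assms(3) uv(1) vs by auto
  qed
  then show ?thesis using uv by simp
qed

lemma subseq_direct_sum_upper:
  assumes "subseq (z # zs) (direct_sum xs ys)" "xs \<in> perms k" "z > k"
  shows "\<exists>vs. z # zs = map (\<lambda>v. v + k) vs \<and> subseq vs ys"
proof -
  have len: "length xs = k" using assms by (simp add: perms_length)
  obtain us vs where uv: "z # zs = us @ map (\<lambda>v. v + k) vs" "subseq us xs" "subseq vs ys"
    using assms(1) unfolding subseq_direct_sum len by blast
  have "us = []"
  proof (rule ccontr)
    assume "us \<noteq> []"
    then obtain us' where "us = z # us'" using uv(1) by (cases us) auto
    then have "z \<in> set xs" using subseqD[OF uv(2)] by simp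
    then show False using assms(2,3) by (simp add: perms_iff)
  qed
  then show ?thesis using uv by simp
qed

lemma subseq_direct_sumI:
  assumes "subseq us xs" "subseq vs ys"
  shows "subseq (us @ map (\<lambda>v. v + length xs) vs) (direct_sum xs ys)"
  unfolding subseq_direct_sum using assms by blast

lemma av3D: "av3 R xs \<Longrightarrow> subseq [x, y, z] xs \<Longrightarrow> R x y \<Longrightarrow> R y z \<Longrightarrow> False"
  unfolding av3_def by blast

lemma av31D:
  "av31 R xs \<Longrightarrow> subseq [x, y, z, w] xs \<Longrightarrow> R x y \<Longrightarrow> R y z \<Longrightarrow> x < w \<Longrightarrow> y < w \<Longrightarrow> z < w \<Longrightarrow> False"
  unfolding av31_def by blast

lemma av3_direct_sum:
  assumes xs: "xs \<in> perms k" and ys: "ys \<in> perms m"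
  shows "av3 (>) (direct_sum xs ys) \<longleftrightarrow> av3 (>) xs \<and> av3 (>) ys"
proof (intro iffI conjI)
  have len: "length xs = k" using xs by (rule perms_length)
  assume av: "av3 (>) (direct_sum xs ys)"
  show "av3 (>) xs" unfolding av3_def
  proof clarify
    fix x y z assume *: "subseq [x, y, z] xs" "x > y" "y > z"
    show False
      using av3D[OF av _ *(2,3)] subseq_direct_sumI[OF *(1), of "[]" ys] by simp
  qed
  show "av3 (>) ys" unfolding av3_def
  proof clarify
    fix x y z assume "subseq [x, y, z] ys" "x > y" "y > z"
    then have "subseq [x + k, y + k, z + k] (direct_sum xs ys)" "x + k > y + k" "y + k > z + k"
      using subseq_direct_sumI[of "[]" xs "[x, y, z]" ys] len by auto
    then show False using av3D[OF av] by blast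
  qed
next
  have len: "length xs = k" using xs by (rule perms_length)
  assume av: "av3 (>) xs \<and> av3 (>) ys"
  show "av3 (>) (direct_sum xs ys)" unfolding av3_def
  proof clarify
    fix x y z assume *: "subseq [x, y, z] (direct_sum xs ys)" "x > y" "y > z"
    show False
    proof (cases "x \<le> k")
      case True
      then have "subseq [x, y, z] xs"
        by (intro subseq_direct_sum_lower[OF *(1) ys]) (use * len in auto)
      then show False using av3D[of "(>)" xs x y z] * av by simp
    next
      case False
      then obtain x' y' z' where s: "x = x' + k" "y = y' + k" "z = z' + k" "subseq [x', y', z'] ys"
        using subseq_direct_sum_upper[OF *(1) xs] by (auto simp: Cons_eq_map_conv)
      have "x' > y'" "y' > z'" using * s by auto
      then show False using av3D[of "(>)" ys x' y' z'] s av by simp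
    qed
  qed
qed

text \<open>Any entry of the nonempty upper summand serves as the \<open>4\<close> above a
  \<open>321\<close> in the lower one. Conversely the \<open>3\<close> decides: if it lies in
  \<open>xs\<close>, the smaller \<open>2\<close> and \<open>1\<close> do too; otherwise the whole
  occurrence lies in the upper summand.\<close>

lemma av31_direct_sum:
  assumes xs: "xs \<in> perms k" and ys: "ys \<in> perms m" and m: "m \<ge> 1"
  shows "av31 (>) (direct_sum xs ys) \<longleftrightarrow> av3 (>) xs \<and> av31 (>) ys"
proof (intro iffI conjI)
  have len: "length xs = k" using xs by (rule perms_length)
  assume av: "av31 (>) (direct_sum xs ys)"
  show "av3 (>) xs" unfolding av3_def
  proof clarify
    fix x y z assume *: "subseq [x, y, z] xs" "x > y" "y > z"
    obtain w where w: "w \<in> set ys" "w \<ge> 1" using ys m by (auto simp: perms_iff)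
    have "x \<le> k" using subseqD[OF *(1)] xs by (auto simp: perms_iff)
    moreover have "subseq [x, y, z, w + k] (direct_sum xs ys)"
      using subseq_direct_sumI[OF *(1), of "[w]" ys] w len by (simp add: subseq_singleton_left)
    ultimately show False using av31D[OF av _ *(2,3), of "w + k"] *(2,3) w by simp
  qed
  show "av31 (>) ys" unfolding av31_def
  proof clarify
    fix x y z w assume "subseq [x, y, z, w] ys" "x > y" "y > z" "x < w" "y < w" "z < w"
    then have "subseq [x + k, y + k, z + k, w + k] (direct_sum xs ys)"
      "x + k > y + k" "y + k > z + k" "x + k < w + k" "y + k < w + k" "z + k < w + k"
      using subseq_direct_sumI[of "[]" xs "[x, y, z, w]" ys] len by auto
    then show False using av31D[OF av] by blast
  qed
next
  have len: "length xs = k" using xs by (rule perms_length)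
  assume av: "av3 (>) xs \<and> av31 (>) ys"
  show "av31 (>) (direct_sum xs ys)" unfolding av31_def
  proof clarify
    fix x y z w assume *: "subseq [x, y, z, w] (direct_sum xs ys)" "x > y" "y > z" "x < w" "y < w" "z < w"
    show False
    proof (cases "x \<le> k")
      case True
      have "subseq [x, y, z] (direct_sum xs ys)"
        using *(1) subseq_order.trans[of "[x, y, z]" "[x, y, z, w]"] by simp
      then have "subseq [x, y, z] xs"
        by (rule subseq_direct_sum_lower[OF _ ys]) (use * True len in auto)
      then show False using av3D[of "(>)" xs x y z] * av by simp
    next
      case False
      then obtain x' y' z' w' where s: "x = x' + k" "y = y' + k" "z = z' + k" "w = w' + k"
          "subseq [x', y', z', w'] ys"
        using subseq_direct_sum_upper[OF *(1) xs] by (auto simp: Cons_eq_map_conv)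
      have "x' > y'" "y' > z'" "x' < w'" "y' < w'" "z' < w'" using * s by auto
      then show False using av31D[of "(>)" ys x' y' z' w'] s av by simp
    qed
  qed
qed

subsection \<open>Generating functions\<close>

definition weight :: "nat list \<Rightarrow> real poly" where
  "weight xs = monom 1 (des xs)"

lemma sum_monom_des:
  assumes "finite S" "\<And>xs. xs \<in> S \<Longrightarrow> des xs < n"
  shows "(\<Sum>i<n. monom (of_nat (card {xs \<in> S. des xs = i})) i) = (\<Sum>xs\<in>S. weight xs)"
proof -
  have "(\<Sum>xs\<in>S. weight xs) = (\<Sum>i<n. \<Sum>xs\<in>{xs \<in> S. des xs = i}. weight xs)"
    by (rule sum.group[symmetric]) (use assms in auto)
  also have "\<dots> = (\<Sum>i<n. monom (of_nat (card {xs \<in> S. des xs = i})) i)"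
    by (intro sum.cong) (auto simp: weight_def of_nat_poly smult_monom simp flip: mult_monom
        intro: trans[OF sum_constant])
  finally show ?thesis ..
qed

lemma A_gf_nth: "fps_nth (A_gf \<sigma>) n =
    (if n = 0 then 1 else \<Sum>xs\<in>{xs \<in> perms n. avoids \<sigma> xs}. weight xs)"
proof (cases "n = 0")
  case False
  have "des xs < n" if "xs \<in> perms n" for xs
    using that False des_less_length[of xs] perms_length[OF that] by auto
  then have "(\<Sum>i<n. monom (of_nat (card {xs \<in> {xs \<in> perms n. avoids \<sigma> xs}. des xs = i})) i) =
      (\<Sum>xs\<in>{xs \<in> perms n. avoids \<sigma> xs}. weight xs)"
    by (intro sum_monom_des) auto
  then show ?thesis using False by (simp add: A_gf_def A_num_def perms_def conj_assoc)
qed (simp add: A_gf_def)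

lemma I_gf_nth: "fps_nth (I_gf \<sigma>) n = (\<Sum>xs\<in>{xs \<in> indec n. avoids \<sigma> xs}. weight xs)"
proof (cases "n = 0")
  case True
  then have "indec n = {}" by (auto simp: indec_def indecomposable_def)
  then show ?thesis using True by (simp add: I_gf_def)
next
  case False
  have "des xs < n" if "xs \<in> indec n" for xs
    using that False des_less_length[of xs] perms_length[of xs n] by (auto simp: indec_def)
  then have "(\<Sum>i<n. monom (of_nat (card {xs \<in> {xs \<in> indec n. avoids \<sigma> xs}. des xs = i})) i) =
      (\<Sum>xs\<in>{xs \<in> indec n. avoids \<sigma> xs}. weight xs)"
    by (intro sum_monom_des) auto
  moreover have "{xs \<in> {xs \<in> indec n. avoids \<sigma> xs}. des xs = i} =
      {xs \<in> permutations_of_set {1..n}. avoids \<sigma> xs \<and> indecomposable xs \<and> des xs = i}" for i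
    by (auto simp: indec_def perms_def)
  ultimately show ?thesis using False by (simp add: I_gf_def I_num_def)
qed

lemma weight_direct_sum: "xs \<in> perms k \<Longrightarrow> weight (direct_sum xs ys) = weight xs * weight ys"
  by (simp add: weight_def des_direct_sum mult_monom)

text \<open>The multiplicative \<open>f\<close> serves both the count by descents and the plain
  count \<open>f = 1\<close>. The term \<open>k = n\<close> is kept apart with the condition
  \<open>P\<close> itself: with nothing above it, an indecomposable \<open>3214\<close>-avoider may
  contain \<open>321\<close>.\<close>

lemma sum_avoiding_direct_sum:
  assumes "n \<ge> 1"
    and P: "\<And>k xs ys. xs \<in> perms k \<Longrightarrow> ys \<in> perms (n - k) \<Longrightarrow> 1 \<le> k \<Longrightarrow> k < n \<Longrightarrow>
      P (direct_sum xs ys) \<longleftrightarrow> Q xs \<and> R ys"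
    and f: "\<And>k xs ys. xs \<in> perms k \<Longrightarrow> f (direct_sum xs ys) = f xs * (f ys :: 'a :: comm_semiring_1)"
  shows "(\<Sum>zs\<in>{zs \<in> perms n. P zs}. f zs) = (\<Sum>zs\<in>{zs \<in> indec n. P zs}. f zs) +
    (\<Sum>k\<in>{1..<n}. (\<Sum>xs\<in>{xs \<in> indec k. Q xs}. f xs) * (\<Sum>ys\<in>{ys \<in> perms (n - k). R ys}. f ys))"
proof -
  let ?g = "\<lambda>zs. if P zs then f zs else 0"
  have "(\<Sum>zs\<in>{zs \<in> perms n. P zs}. f zs) = (\<Sum>zs\<in>perms n. ?g zs)"
    by (rule sum.inter_filter) simp
  also have "\<dots> = (\<Sum>k\<in>{1..n}. \<Sum>xs\<in>indec k. \<Sum>ys\<in>perms (n - k). ?g (direct_sum xs ys))"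
    by (rule sum_direct_sum[OF assms(1)])
  also have "{1..n} = insert n {1..<n}" using assms(1) by auto
  also have "(\<Sum>k\<in>insert n {1..<n}. \<Sum>xs\<in>indec k. \<Sum>ys\<in>perms (n - k). ?g (direct_sum xs ys)) =
      (\<Sum>xs\<in>indec n. ?g xs) +
      (\<Sum>k\<in>{1..<n}. \<Sum>xs\<in>indec k. \<Sum>ys\<in>perms (n - k). ?g (direct_sum xs ys))"
  proof -
    have "(\<Sum>ys\<in>perms (n - n). ?g (direct_sum xs ys)) = ?g xs" for xs
      unfolding diff_self_eq_0 perms_0 by (simp add: direct_sum_def)
    then show ?thesis by (simp only: sum.insert finite_atLeastLessThan atLeastLessThan_iff less_irrefl simp_thms not_False_eq_True)
  qed
  also have "(\<Sum>xs\<in>indec n. ?g xs) = (\<Sum>zs\<in>{zs \<in> indec n. P zs}. f zs)"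
    by (rule sum.inter_filter[symmetric]) simp
  also have "(\<Sum>k\<in>{1..<n}. \<Sum>xs\<in>indec k. \<Sum>ys\<in>perms (n - k). ?g (direct_sum xs ys)) =
      (\<Sum>k\<in>{1..<n}. (\<Sum>xs\<in>{xs \<in> indec k. Q xs}. f xs) * (\<Sum>ys\<in>{ys \<in> perms (n - k). R ys}. f ys))"
  proof (rule sum.cong[OF refl])
    fix k assume k: "k \<in> {1..<n}"
    have "(\<Sum>xs\<in>indec k. \<Sum>ys\<in>perms (n - k). ?g (direct_sum xs ys)) =
        (\<Sum>xs\<in>indec k. \<Sum>ys\<in>perms (n - k). (if Q xs then f xs else 0) * (if R ys then f ys else 0))"
      using k P f by (intro sum.cong refl) (auto simp: indec_def)
    also have "\<dots> = (\<Sum>xs\<in>indec k. if Q xs then f xs else 0) * (\<Sum>ys\<in>perms (n - k). if R ys then f ys else 0)"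
      by (rule sum_product[symmetric])
    finally show "(\<Sum>xs\<in>indec k. \<Sum>ys\<in>perms (n - k). ?g (direct_sum xs ys)) =
        (\<Sum>xs\<in>{xs \<in> indec k. Q xs}. f xs) * (\<Sum>ys\<in>{ys \<in> perms (n - k). R ys}. f ys)"
      by (simp add: sum.inter_filter)
  qed
  finally show ?thesis .
qed

lemma fps_mult_nth_without_ends:
  fixes F G :: "'a :: comm_ring_1 fps"
  assumes "fps_nth F 0 = 0" "fps_nth G 0 = 0"
  shows "fps_nth (F * G) n = (\<Sum>k\<in>{1..<n}. fps_nth F k * fps_nth G (n - k))"
  unfolding fps_mult_nth
  by (rule sum.mono_neutral_right) (use assms in \<open>auto simp: not_less le_Suc_eq Suc_le_eq\<close>)

lemma I_gf_nth_0: "fps_nth (I_gf \<sigma>) 0 = 0"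
  by (simp add: I_gf_def)

lemma A_gf_3214: "A_gf [3,2,1,4] = 1 + I_gf [3,2,1,4] + I_gf [3,2,1] * (A_gf [3,2,1,4] - 1)"
proof (rule fps_ext)
  fix n
  have G0: "fps_nth (A_gf [3,2,1,4] - 1) 0 = 0" by (simp add: A_gf_nth)
  show "fps_nth (A_gf [3,2,1,4]) n =
      fps_nth (1 + I_gf [3,2,1,4] + I_gf [3,2,1] * (A_gf [3,2,1,4] - 1)) n"
  proof (cases "n = 0")
    case True
    then show ?thesis by (simp add: A_gf_nth I_gf_nth_0)
  next
    case False
    have "fps_nth (A_gf [3,2,1,4]) n = (\<Sum>zs\<in>{zs \<in> perms n. av31 (>) zs}. weight zs)"
      using False unfolding A_gf_nth avoids_3214 by simp
    also have "\<dots> = (\<Sum>zs\<in>{zs \<in> indec n. av31 (>) zs}. weight zs) +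
      (\<Sum>k\<in>{1..<n}. (\<Sum>xs\<in>{xs \<in> indec k. av3 (>) xs}. weight xs) *
        (\<Sum>ys\<in>{ys \<in> perms (n - k). av31 (>) ys}. weight ys))"
      by (rule sum_avoiding_direct_sum) (use False in \<open>auto simp: av31_direct_sum weight_direct_sum\<close>)
    also have "\<dots> = fps_nth (I_gf [3,2,1,4]) n +
      (\<Sum>k\<in>{1..<n}. fps_nth (I_gf [3,2,1]) k * fps_nth (A_gf [3,2,1,4] - 1) (n - k))"
      unfolding I_gf_nth avoids_3214 avoids_321
      by (intro arg_cong2[where f = "(+)"] sum.cong refl arg_cong2[where f = "(*)"])
         (auto simp: A_gf_nth avoids_3214[simplified] avoids_3214)
    finally show ?thesis
      using False fps_mult_nth_without_ends[OF I_gf_nth_0 G0] by simp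
  qed
qed

lemma I_gf1_nth_indec:
  "fps_nth (I_gf1 \<sigma>) n = real (card {xs \<in> indec n. avoids \<sigma> xs})"
proof -
  have "poly (weight xs) 1 = 1" for xs by (simp add: weight_def poly_monom)
  then show ?thesis by (simp add: I_gf1_def I_gf_nth poly_sum)
qed

lemma I_gf1_nth_0: "fps_nth (I_gf1 \<sigma>) 0 = 0"
  by (simp add: I_gf1_def I_gf_nth_0)

lemma E_num_eq: "E_num n = card {xs \<in> perms n. av31 (>) xs}"
  unfolding E_num_def avoids_1234 perms_def[symmetric] by (rule wilf_1234_3214)

lemma perms_0_filter: "P [] \<Longrightarrow> {xs \<in> perms 0. P xs} = {[]}"
  by auto

lemma av_Nil: "av31 R []" "av3 R []"
  by (simp_all add: av31_def av3_def)

lemma E_num_0: "E_num 0 = 1"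
  by (simp add: E_num_eq perms_0_filter av_Nil del: perms_0)

text \<open>The identity for \<open>A_gf\<close> at \<open>q = 1\<close>, where Wilf equivalence
  turns the left side into \<open>E_gf\<close>; it is the same decomposition with all weights
  1.\<close>

lemma E_gf_eq: "E_gf = 1 + I_gf1 [3,2,1,4] + I_gf1 [3,2,1] * (E_gf - 1)"
proof (rule fps_ext)
  fix n
  have G0: "fps_nth (E_gf - 1) 0 = 0" by (simp add: E_gf_def E_num_0)
  show "fps_nth E_gf n = fps_nth (1 + I_gf1 [3,2,1,4] + I_gf1 [3,2,1] * (E_gf - 1)) n"
  proof (cases "n = 0")
    case True
    then show ?thesis by (simp add: E_gf_def E_num_0 I_gf1_nth_0)
  next
    case False
    have "fps_nth E_gf n = (\<Sum>zs\<in>{zs \<in> perms n. av31 (>) zs}. 1 :: real)"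
      by (simp add: E_gf_def E_num_eq)
    also have "\<dots> = (\<Sum>zs\<in>{zs \<in> indec n. av31 (>) zs}. 1) +
      (\<Sum>k\<in>{1..<n}. (\<Sum>xs\<in>{xs \<in> indec k. av3 (>) xs}. 1) * (\<Sum>ys\<in>{ys \<in> perms (n - k). av31 (>) ys}. 1))"
      by (rule sum_avoiding_direct_sum) (use False in \<open>auto simp: av31_direct_sum\<close>)
    also have "\<dots> = fps_nth (I_gf1 [3,2,1,4]) n +
      (\<Sum>k\<in>{1..<n}. fps_nth (I_gf1 [3,2,1]) k * fps_nth (E_gf - 1) (n - k))"
      unfolding I_gf1_nth_indec avoids_3214 avoids_321
      by (intro arg_cong2[where f = "(+)"] sum.cong refl arg_cong2[where f = "(*)"])
         (auto simp: E_gf_def E_num_eq)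
    finally show ?thesis
      using False fps_mult_nth_without_ends[OF I_gf1_nth_0 G0] by simp
  qed
qed

lemma card_av321_catalan: "real (card {xs \<in> perms n. av3 (>) xs}) = catalan n"
  by (simp add: card_av321 descendants_0_catalan)

lemma I_gf1_321: "I_gf1 [3,2,1] = fps_X * catalan_fps"
proof -
  let ?I = "I_gf1 [3,2,1]"
  have G0: "fps_nth (catalan_fps - 1) 0 = 0" by (simp add: catalan_fps_def catalan_0)
  have "catalan_fps = 1 + ?I + ?I * (catalan_fps - 1)"
  proof (rule fps_ext)
    fix n
    show "fps_nth catalan_fps n = fps_nth (1 + ?I + ?I * (catalan_fps - 1)) n"
    proof (cases "n = 0")
      case True
      then show ?thesis by (simp add: catalan_fps_def catalan_0 I_gf1_nth_0)
    next
      case False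
      have "fps_nth catalan_fps n = (\<Sum>zs\<in>{zs \<in> perms n. av3 (>) zs}. 1 :: real)"
        by (simp add: catalan_fps_def card_av321_catalan)
      also have "\<dots> = (\<Sum>zs\<in>{zs \<in> indec n. av3 (>) zs}. 1) +
        (\<Sum>k\<in>{1..<n}. (\<Sum>xs\<in>{xs \<in> indec k. av3 (>) xs}. 1) * (\<Sum>ys\<in>{ys \<in> perms (n - k). av3 (>) ys}. 1))"
        by (rule sum_avoiding_direct_sum) (use False in \<open>auto simp: av3_direct_sum\<close>)
      also have "\<dots> = fps_nth ?I n + (\<Sum>k\<in>{1..<n}. fps_nth ?I k * fps_nth (catalan_fps - 1) (n - k))"
        unfolding I_gf1_nth_indec avoids_321
        by (intro arg_cong2[where f = "(+)"] sum.cong refl arg_cong2[where f = "(*)"])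
           (auto simp: catalan_fps_def card_av321_catalan)
      finally show ?thesis
        using False fps_mult_nth_without_ends[OF I_gf1_nth_0 G0] by simp
    qed
  qed
  then have "catalan_fps = 1 + ?I * catalan_fps" by (simp add: algebra_simps)
  \<comment> \<open>Comparison with the quadratic equation identifies \<open>?I\<close> once the
    factor \<open>catalan_fps\<close> is cancelled, which is nonzero because its constant term is
    1.\<close>
  then have "1 + ?I * catalan_fps = 1 + (fps_X * catalan_fps) * catalan_fps"
    using catalan_fps_eq by (metis mult.assoc power2_eq_square)
  then have "?I * catalan_fps = (fps_X * catalan_fps) * catalan_fps"
    by (rule add_left_imp_eq)
  moreover have "catalan_fps \<noteq> 0"
    using catalan_0 by (metis catalan_fps_def fps_nth_Abs_fps fps_zero_nth zero_neq_one)
  ultimately show ?thesis by simp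
qed

lemma I_gf1_3214_factored: "I_gf1 [3,2,1,4] = (1 - fps_X * catalan_fps) * (E_gf - 1)"
  using E_gf_eq unfolding I_gf1_321 by (simp add: algebra_simps)

lemma I_gf1_3214: "I_gf1 [3,2,1,4] =
    fps_const (1/2) * (fps_radical root 2 (1 - 4 * fps_X) + 1) * (E_gf - 1)"
proof -
  have "fps_const (1/2) * (1 - 2 * fps_X * catalan_fps + 1) = 1 - fps_X * catalan_fps"
    by (rule fps_ext) (simp add: numeral_fps_const mult.assoc)
  then show ?thesis unfolding I_gf1_3214_factored fps_radical_catalan by simp
qed

lemma I_gf1_3214_nth:
  assumes "n \<ge> 1"
  shows "fps_nth (I_gf1 [3,2,1,4]) n =
    real (E_num n) - (\<Sum>k\<in>{1..<n}. catalan (k - 1) * real (E_num (n - k)))"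
proof -
  have X0: "fps_nth (fps_X * catalan_fps) 0 = 0" by simp
  have G0: "fps_nth (E_gf - 1) 0 = 0" by (simp add: E_gf_def E_num_0)
  have "fps_nth (I_gf1 [3,2,1,4]) n = fps_nth (E_gf - 1) n - fps_nth ((fps_X * catalan_fps) * (E_gf - 1)) n"
    unfolding I_gf1_3214_factored by (simp only: left_diff_distrib mult_1 fps_sub_nth)
  also have "fps_nth ((fps_X * catalan_fps) * (E_gf - 1)) n =
      (\<Sum>k\<in>{1..<n}. catalan (k - 1) * real (E_num (n - k)))"
    unfolding fps_mult_nth_without_ends[OF X0 G0]
    by (intro sum.cong) (auto simp: catalan_fps_def E_gf_def)
  finally show ?thesis using assms by (simp add: E_gf_def)
qed

lemma E_num_1: "E_num 1 = 1"
proof -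
  have "{xs \<in> perms 1. av31 (>) xs} = {[1]}"
    by (auto simp: perms_def av31_def subseq_Cons')
  then show ?thesis by (simp add: E_num_eq)
qed

theorem theorem3p11:
  shows "A_gf [3,2,1,4] = 1 + I_gf [3,2,1,4] + I_gf [3,2,1] * (A_gf [3,2,1,4] - 1) \<and>
    I_gf1 [3,2,1,4] =
      fps_const (1/2) * (fps_radical root 2 (1 - 4 * fps_X) + 1) * (E_gf - 1) \<and>
    fps_nth (I_gf1 [3,2,1,4]) 1 = 1 \<and>
    (\<forall>n\<ge>2. fps_nth (I_gf1 [3,2,1,4]) n =
       real (E_num n) - (\<Sum>i=0..n-2. catalan i * real (E_num (n - 1 - i))))"
proof (intro conjI allI impI)
  show "fps_nth (I_gf1 [3,2,1,4]) 1 = 1"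
    using I_gf1_3214_nth[of 1] E_num_1 by simp
next
  fix n :: nat assume n: "n \<ge> 2"
  have "(\<Sum>k\<in>{1..<n}. catalan (k - 1) * real (E_num (n - k))) =
      (\<Sum>i=0..n-2. catalan i * real (E_num (n - 1 - i)))"
    by (rule sum.reindex_bij_witness[of _ Suc "\<lambda>k. k - 1"]) (use n in auto)
  then show "fps_nth (I_gf1 [3,2,1,4]) n =
      real (E_num n) - (\<Sum>i=0..n-2. catalan i * real (E_num (n - 1 - i)))"
    using I_gf1_3214_nth[of n] n by simp
qed (fact A_gf_3214 I_gf1_3214)+

end
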